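(* For every integer $n \geq 7$, $$ \begin{cases} 3n-3\leq R(W_{n},W_{n})\leq 8n-10, & \text{ if $n$ is even;}\\ 2n-2\leq R(W_{n},W_{n})\leq 6n-8, & \text{ if $n$ is odd.} \end{cases} $$
   Context: For $n \geq 4$, the wheel $W_n$ is the graph of order $n$ given by $W_n = K_1 \vee C_{n-1}$, i.e., a cycle on $n-1$ vertices together with one additional vertex adjacent to all vertices of the cycle. For graphs $G,H$, the Ramsey number $R(G,H)$ is the minimum integer $N$ such that every coloring of the edges of $K_N$ with colors red and blue contains a red copy of $G$ or a blue copy of $H$. *)

theory Defs
  imports Main "HOL-Library.Ramsey"
begin

record 'a ugraph =
  verts :: "'a set"
  edges :: "'a set set"

definition simple_graph :: "'a ugraph \<Rightarrow> bool" where
  "simple_graph G \<longleftrightarrow> finite (verts G) \<and> edges G \<subseteq> [verts G]\<^bsup>2\<^esup>"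

definition complete_graph :: "nat \<Rightarrow> nat ugraph" where
  "complete_graph m = \<lparr>verts = {..<m}, edges = [{..<m}]\<^bsup>2\<^esup>\<rparr>"

text \<open>A simple graph only for \<open>m \<ge> 3\<close>.\<close>
definition cycle_graph :: "nat \<Rightarrow> nat ugraph" where
  "cycle_graph m = \<lparr>verts = {..<m}, edges = {{i, Suc i mod m} | i. i < m}\<rparr>"

text \<open>The join is taken on the disjoint sum of the two vertex sets.\<close>
definition graph_join :: "'a ugraph \<Rightarrow> 'b ugraph \<Rightarrow> ('a + 'b) ugraph" where
  "graph_join G H =
     \<lparr>verts = verts G <+> verts H,
      edges = (\<lambda>e. Inl ` e) ` edges G \<union> (\<lambda>e. Inr ` e) ` edges H
              \<union> {{Inl x, Inr y} | x y. x \<in> verts G \<and> y \<in> verts H}\<rparr>"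

text \<open>\<open>n\<close> is the number of vertices, so the rim has length \<open>n - 1\<close>;
  meaningful for \<open>n \<ge> 4\<close>.\<close>
definition wheel :: "nat \<Rightarrow> (nat + nat) ugraph" where
  "wheel n = graph_join (complete_graph 1) (cycle_graph (n - 1))"

text \<open>Copies are subgraphs, not necessarily induced.\<close>
definition contains_copy :: "'b ugraph \<Rightarrow> 'a ugraph \<Rightarrow> bool" where
  "contains_copy G H \<longleftrightarrow>
     (\<exists>f. inj_on f (verts H) \<and> f ` verts H \<subseteq> verts G \<and> (\<forall>e\<in>edges H. f ` e \<in> edges G))"

datatype colour = Red | Blue

definition colour_subgraph :: "('a set \<Rightarrow> colour) \<Rightarrow> colour \<Rightarrow> 'a ugraph \<Rightarrow> 'a ugraph" where
  "colour_subgraph c k G = \<lparr>verts = verts G, edges = {e \<in> edges G. c e = k}\<rparr>"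

text \<open>A colouring is a total function on sets of vertices; only its values on edges matter.\<close>
definition ramsey_arrows :: "nat \<Rightarrow> 'a ugraph \<Rightarrow> 'b ugraph \<Rightarrow> bool" where
  "ramsey_arrows N G H \<longleftrightarrow>
     (\<forall>c. contains_copy (colour_subgraph c Red (complete_graph N)) G
        \<or> contains_copy (colour_subgraph c Blue (complete_graph N)) H)"

definition ramsey_number :: "'a ugraph \<Rightarrow> 'b ugraph \<Rightarrow> nat" where
  "ramsey_number G H = (LEAST N. ramsey_arrows N G H)"

lemma contains_copy_clique:
  assumes "simple_graph H" and "finite R" and "card R = card (verts H)"
    and "R \<subseteq> verts G" and "[R]\<^bsup>2\<^esup> \<subseteq> edges G"
  shows "contains_copy G H"
proof -
  obtain f where f: "bij_betw f (verts H) R"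
    using assms finite_same_card_bij unfolding simple_graph_def by metis
  have "f ` e \<in> edges G" if "e \<in> edges H" for e
  proof -
    have e: "e \<in> [verts H]\<^bsup>2\<^esup>"
      using that assms(1) by (auto simp: simple_graph_def)
    then obtain x y where "e = {x, y}" "x \<in> verts H" "y \<in> verts H" "x \<noteq> y"
      by (rule nsets2_E)
    then have "f ` e \<in> [R]\<^bsup>2\<^esup>"
      using f by (auto simp: bij_betw_def inj_on_def)
    then show ?thesis
      using assms(5) by blast
  qed
  then show ?thesis
    using f assms(4) unfolding contains_copy_def bij_betw_def by blast
qed

text \<open>Hence the minimum defining \<^const>\<open>ramsey_number\<close> exists.\<close>
lemma ramsey_arrows_exists:
  assumes "simple_graph G" and "simple_graph H"
  shows "\<exists>N. ramsey_arrows N G H"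
proof -
  obtain r where r: "\<forall>(V::nat set) E. finite V \<and> card V \<ge> r \<longrightarrow>
      (\<exists>R\<subseteq>V. card R = card (verts G) \<and> clique R E \<or> card R = card (verts H) \<and> indep R E)"
    using ramsey2[of "card (verts G)" "card (verts H)"] by metis
  have "contains_copy (colour_subgraph c Red (complete_graph r)) G
      \<or> contains_copy (colour_subgraph c Blue (complete_graph r)) H" for c
  proof -
    obtain R where R: "R \<subseteq> {..<r}"
      and alt: "card R = card (verts G) \<and> clique R {e. c e = Red} \<or>
                card R = card (verts H) \<and> indep R {e. c e = Red}"
      using r[rule_format, of "{..<r}" "{e. c e = Red}"] by auto
    have fin: "finite R" using R finite_subset by blast
    have blue: "c e \<noteq> Red \<Longrightarrow> c e = Blue" for e by (cases "c e") auto
    from alt show ?thesis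
    proof
      assume A: "card R = card (verts G) \<and> clique R {e. c e = Red}"
      have "[R]\<^bsup>2\<^esup> \<subseteq> edges (colour_subgraph c Red (complete_graph r))"
        using A R by (auto simp: colour_subgraph_def complete_graph_def clique_def elim!: nsets2_E)
      then show ?thesis
        using contains_copy_clique[OF assms(1) fin] A R
        by (auto simp: colour_subgraph_def complete_graph_def)
    next
      assume A: "card R = card (verts H) \<and> indep R {e. c e = Red}"
      have "[R]\<^bsup>2\<^esup> \<subseteq> edges (colour_subgraph c Blue (complete_graph r))"
        using A R blue by (auto simp: colour_subgraph_def complete_graph_def indep_def elim!: nsets2_E)
      then show ?thesis
        using contains_copy_clique[OF assms(2) fin] A R
        by (auto simp: colour_subgraph_def complete_graph_def)
    qed
  qed
  then show ?thesis
    unfolding ramsey_arrows_def by blast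
qed

lemma simple_graph_wheel:
  assumes "n \<ge> 4"
  shows "simple_graph (wheel n)" and "card (verts (wheel n)) = n"
proof -
  have neq: "i \<noteq> Suc i mod (n - 1)" if "i < n - 1" for i
  proof (cases "Suc i = n - 1")
    case True
    then show ?thesis using assms by auto
  next
    case False
    then show ?thesis using that by simp
  qed
  have K: "edges (complete_graph 1) = {}"
    by (auto simp: complete_graph_def elim!: nsets2_E)
  have C: "\<exists>x y. e = {x, y} \<and> x < n - 1 \<and> y < n - 1 \<and> x \<noteq> y"
    if e: "e \<in> edges (cycle_graph (n - 1))" for e
  proof -
    obtain i where i: "i < n - 1" "e = {i, Suc i mod (n - 1)}"
      using e by (auto simp: cycle_graph_def)
    moreover have "Suc i mod (n - 1) < n - 1" using assms by simp
    ultimately show ?thesis using neq by blast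
  qed
  have V: "verts (wheel n) = {..<1} <+> {..<n - 1}"
    by (simp add: wheel_def graph_join_def complete_graph_def cycle_graph_def)
  have "e \<in> [verts (wheel n)]\<^bsup>2\<^esup>" if "e \<in> edges (wheel n)" for e
  proof -
    from that consider e' where "e' \<in> edges (cycle_graph (n - 1))" "e = Inr ` e'"
      | x y where "e = {Inl x, Inr y}" "x < 1" "y < n - 1"
      unfolding wheel_def graph_join_def ugraph.simps K
      by (auto simp: complete_graph_def cycle_graph_def)
    then show ?thesis
    proof cases
      case 1
      then obtain x y where "e' = {x, y}" "x < n - 1" "y < n - 1" "x \<noteq> y"
        using C by blast
      then show ?thesis
        unfolding V using 1 by (simp add: InrI)
    next
      case 2
      then show ?thesis
        unfolding V by (simp add: InlI InrI)
    qed
  qed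
  then show "simple_graph (wheel n)"
    unfolding simple_graph_def by (auto simp: V)
  show "card (verts (wheel n)) = n"
    using assms
    by (simp add: V card_Plus)
qed

end

theory Submission
  imports Defs
begin

text \<open>
  Write \<open>m = n - 1\<close> for the length of the rim and let \<open>r\<close> be such that every 2-colouring of \<open>K\<^sub>r\<close>
  contains a monochromatic \<open>C\<^sub>m\<close>. In a colouring of the complete graph on \<open>4r + 2\<close> vertices some vertex
  has, say, a red neighbourhood \<open>A\<close> of size \<open>2r + 1\<close>. If some \<open>x \<in> A\<close> has \<open>r\<close> blue neighbours in \<open>A\<close>,
  a monochromatic \<open>C\<^sub>m\<close> among them is the rim of a wheel of either colour. Otherwise the red degrees
  inside \<open>A\<close> exceed \<open>\<bar>A\<bar> / 2\<close>, so a Dirac-type argument gives a red \<open>C\<^sub>m\<close> in \<open>A\<close>.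

  It remains to prove that \<open>r = 3k - 1\<close> works for \<open>m = 2k\<close>, and \<open>r = 4k - 3\<close> for \<open>m = 2k - 1\<close>.
  A longest monochromatic cycle, say red, cannot be shorter than \<open>2k\<close>: the red neighbourhoods on it of
  outside vertices are so restricted that a longer blue cycle zigzags between the cycle and the outside.
  Long monochromatic cycles can then be shortened to length \<open>2k\<close> inside their own vertex set,
  and a monochromatic \<open>C\<^sub>2\<^sub>k\<close> yields a \<open>C\<^sub>2\<^sub>k\<^sub>-\<^sub>1\<close>, since otherwise its even and its odd vertices
  would form cliques of the other colour.
\<close>

subsection \<open>Cycles in 2-coloured complete graphs\<close>

text \<open>Lists of length 1 and 2 satisfy this too; the lengths that matter are at least 3, where
  it is a cycle in the usual sense.\<close>

definition cycle_in :: "('a \<Rightarrow> 'a \<Rightarrow> bool) \<Rightarrow> 'a set \<Rightarrow> 'a list \<Rightarrow> bool" where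
  "cycle_in E V xs \<longleftrightarrow> xs \<noteq> [] \<and> distinct xs \<and> set xs \<subseteq> V \<and> successively E xs \<and> E (last xs) (hd xs)"

definition has_cycle :: "('a \<Rightarrow> 'a \<Rightarrow> bool) \<Rightarrow> 'a set \<Rightarrow> nat \<Rightarrow> bool" where
  "has_cycle E V m \<longleftrightarrow> (\<exists>xs. cycle_in E V xs \<and> length xs = m)"

text \<open>A symmetric \<open>E\<close> is the red graph and its negation the blue one, so
  exchanging the colours is negating \<open>E\<close>, and each argument for red transfers to
  blue.\<close>

definition has_mono_cycle :: "('a \<Rightarrow> 'a \<Rightarrow> bool) \<Rightarrow> 'a set \<Rightarrow> nat \<Rightarrow> bool" where
  "has_mono_cycle E V m \<longleftrightarrow> has_cycle E V m \<or> has_cycle (\<lambda>x y. \<not> E x y) V m"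

text \<open>A cycle of length \<open>L\<close> as an \<open>L\<close>-periodic map on the integers, so that all index
  arithmetic on the cycle is ordinary integer arithmetic.\<close>
definition cycle_map :: "('a \<Rightarrow> 'a \<Rightarrow> bool) \<Rightarrow> 'a set \<Rightarrow> int \<Rightarrow> (int \<Rightarrow> 'a) \<Rightarrow> bool" where
  "cycle_map E V L v \<longleftrightarrow> L > 0 \<and> range v \<subseteq> V \<and>
     (\<forall>i j. v i = v j \<longleftrightarrow> i mod L = j mod L) \<and> (\<forall>i. E (v i) (v (i + 1)))"

lemma has_cycleI:
  "cycle_in E V xs \<Longrightarrow> length xs = m \<Longrightarrow> has_cycle E V m"
  by (auto simp: has_cycle_def)

lemma has_mono_cycle_neg:
  "has_mono_cycle (\<lambda>x y. \<not> E x y) V m \<longleftrightarrow> has_mono_cycle E V m"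
  by (auto simp: has_mono_cycle_def)

lemma has_cycle_mono:
  assumes "has_cycle E V m" "V \<subseteq> W"
  shows "has_cycle E W m"
proof -
  obtain xs where "cycle_in E V xs" "length xs = m" using assms(1) by (auto simp: has_cycle_def)
  then have "cycle_in E W xs" using assms(2) by (auto simp: cycle_in_def)
  with \<open>length xs = m\<close> show ?thesis by (auto simp: has_cycle_def)
qed

lemma symp_neg: "symp E \<Longrightarrow> symp (\<lambda>x y. \<not> E x y)"
  by (blast intro: sympI dest: sympD)

lemma cycle_in_cycle_map:
  assumes "cycle_in E V xs"
  obtains v where "cycle_map E V (int (length xs)) v" "range v = set xs"
proof
  define L where "L = int (length xs)"
  define v where "v = (\<lambda>i. xs ! nat (i mod L))"
  have L: "L > 0" and ne: "xs \<noteq> []" using assms by (auto simp: L_def cycle_in_def)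
  have lt: "nat (i mod L) < length xs" for i
    using L by (simp add: L_def nat_less_iff)
  show r: "range v = set xs"
  proof
    show "range v \<subseteq> set xs" using lt by (auto simp: v_def)
    show "set xs \<subseteq> range v"
    proof
      fix x assume "x \<in> set xs"
      then obtain i where i: "i < length xs" "x = xs ! i" by (auto simp: in_set_conv_nth)
      then have "x = v (int i)" by (simp add: v_def L_def)
      then show "x \<in> range v" by blast
    qed
  qed
  have inj: "v i = v j \<longleftrightarrow> i mod L = j mod L" for i j
  proof -
    have "v i = v j \<longleftrightarrow> nat (i mod L) = nat (j mod L)"
      using assms lt by (auto simp: v_def cycle_in_def nth_eq_iff_index_eq)
    also have "\<dots> \<longleftrightarrow> i mod L = j mod L" using L by (simp add: eq_nat_nat_iff)
    finally show ?thesis .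
  qed
  have step: "E (v i) (v (i + 1))" for i
  proof (cases "Suc (nat (i mod L)) < length xs")
    case True
    then have "i mod L + 1 < L" using L by (simp add: L_def)
    then have "(i + 1) mod L = i mod L + 1"
      using L mod_pos_pos_trivial[of "i mod L + 1" L] by (simp add: mod_simps)
    then have "nat ((i + 1) mod L) = Suc (nat (i mod L))" using L by (simp add: nat_add_distrib)
    then show ?thesis using True assms by (simp add: v_def cycle_in_def successively_conv_nth)
  next
    case False
    then have last: "nat (i mod L) = length xs - 1" using lt[of i] by simp
    moreover have "length xs > 0" using ne by simp
    moreover have "i mod L = int (nat (i mod L))" using L by simp
    ultimately have "i mod L = L - 1" unfolding L_def by linarith
    then have "(i + 1) mod L = 0"
      using mod_add_left_eq[of i L 1] by simp
    then show ?thesis using last assms ne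
      by (simp add: v_def cycle_in_def last_conv_nth hd_conv_nth)
  qed
  show "cycle_map E V (int (length xs)) v"
    using L inj step r assms unfolding L_def[symmetric] cycle_map_def by (auto simp: cycle_in_def)
qed

text \<open>The difference of the indices is a multiple of \<open>L\<close> below \<open>L\<close>
  in absolute value. The free start \<open>a\<close> lets each construction pick the window that
  suits it.\<close>

lemma cycle_map_inj_window:
  assumes "cycle_map E V L v" "v i = v j" "i \<in> {a..<a + L}" "j \<in> {a..<a + L}"
  shows "i = j"
proof -
  have "i mod L = j mod L" using assms by (auto simp: cycle_map_def)
  then have dvd: "L dvd i - j" by (simp add: mod_eq_dvd_iff)
  have "\<bar>i - j\<bar> < L" using assms(3,4) by auto
  then have "i - j = 0"
    using dvd dvd_imp_le_int[of "i - j" L] by force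
  then show ?thesis by simp
qed

lemma cycle_map_step: "cycle_map E V L v \<Longrightarrow> E (v i) (v (i + 1))"
  by (auto simp: cycle_map_def)

lemma cycle_map_add_period: "cycle_map E V L v \<Longrightarrow> v (i + L) = v i"
  by (auto simp: cycle_map_def)

lemma cycle_map_shift:
  assumes "cycle_map E V L v"
  shows "cycle_map E V L (\<lambda>i. v (i + c))"
proof -
  have "(i + c) mod L = (j + c) mod L \<longleftrightarrow> i mod L = j mod L" for i j
    by (simp add: mod_eq_dvd_iff)
  moreover have "E (v (i + c)) (v (i + 1 + c))" for i
    using cycle_map_step[OF assms, of "i + c"] by (simp add: algebra_simps)
  ultimately show ?thesis
    using assms unfolding cycle_map_def by auto
qed

lemma cycle_map_card:
  assumes "cycle_map E V L v"
  shows "range v = v ` {0..<L}" "card (range v) = nat L"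
proof -
  show r: "range v = v ` {0..<L}"
  proof
    show "range v \<subseteq> v ` {0..<L}"
    proof
      fix x assume "x \<in> range v"
      then obtain i where "x = v i" by blast
      then have "x = v (i mod L)" using assms by (simp add: cycle_map_def)
      then show "x \<in> v ` {0..<L}" using assms by (auto simp: cycle_map_def)
    qed
  qed auto
  have "inj_on v {0..<L}"
    using cycle_map_inj_window[OF assms, of _ _ 0] by (auto intro!: inj_onI)
  then show "card (range v) = nat L" unfolding r by (simp add: card_image)
qed

text \<open>The tool for recombining a cycle: a new cycle is a list of indices within one period, so
  distinctness is checked on integers. \<open>G\<close> may differ from \<open>E\<close>, because
  blue cycles are built on the vertices of a red one.\<close>

lemma cycle_in_mapI:
  assumes "cycle_map E V L v" "is \<noteq> []" "distinct is" "set is \<subseteq> {a..<a + L}"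
    "successively (\<lambda>i j. G (v i) (v j)) is" "G (v (last is)) (v (hd is))"
  shows "cycle_in G V (map v is)"
proof -
  have "inj_on v (set is)"
    using cycle_map_inj_window[OF assms(1), of _ _ a] assms(4)
    by (intro inj_onI) (metis subsetD)
  then show ?thesis
    using assms by (auto simp: cycle_in_def distinct_map successively_map last_map hd_map cycle_map_def)
qed

lemma successively_upto:
  assumes "\<And>k. i \<le> k \<Longrightarrow> k < j \<Longrightarrow> P k (k + 1)"
  shows "successively P [i..j]"
  using assms
proof (induction i j rule: upto.induct)
  case (1 i j)
  show ?case
  proof (cases "i < j")
    case True
    then have "[i..j] = i # (i + 1) # [i + 2..j]" "[i + 1..j] = (i + 1) # [i + 2..j]"
      using upto_rec1[of i j] upto_rec1[of "i + 1" j] by (simp_all add: algebra_simps)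
    then show ?thesis using 1 True by auto
  next
    case False
    then show ?thesis by (cases "i = j") auto
  qed
qed

lemma symp_commute: "symp E \<Longrightarrow> E x y \<longleftrightarrow> E y x"
  by (blast dest: sympD)

lemma successively_rev_sym: "symp E \<Longrightarrow> successively E (rev xs) \<longleftrightarrow> successively E xs"
proof -
  assume "symp E"
  then have "(\<lambda>x y. E y x) = E" by (intro ext) (rule symp_commute)
  then show ?thesis by (simp only: successively_rev)
qed

lemma hd_last_upto: "i \<le> j \<Longrightarrow> hd [i..j] = i" "i \<le> j \<Longrightarrow> last [i..j] = (j::int)"
  using upto_rec1[of i j] upto_rec2[of i j] by (metis list.sel(1), metis last_snoc)

lemma cycle_map_arc:
  assumes "cycle_map E V L v"
  shows "successively (\<lambda>i j. E (v i) (v j)) [i..j]"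
  using assms by (intro successively_upto) (auto simp: cycle_map_def)

lemma cycle_map_rev_arc:
  assumes "cycle_map E V L v" "symp E"
  shows "successively (\<lambda>i j. E (v i) (v j)) (rev [i..j])"
proof -
  have "symp (\<lambda>i j. E (v i) (v j))" using assms(2) by (blast intro: sympI dest: sympD)
  then show ?thesis using cycle_map_arc[OF assms(1)] by (simp only: successively_rev_sym)
qed

subsection \<open>Shortening monochromatic cycles\<close>

lemma cycle_map_skip_vertex:
  assumes "cycle_map E V L v" "L > 2" "E (v i) (v (i + 2))"
  shows "has_cycle E V (nat (L - 1))"
proof -
  have "cycle_in E V (map v [i + 2..i + L])"
    using assms cycle_map_arc[OF assms(1)] cycle_map_add_period[OF assms(1), of i]
    by (intro cycle_in_mapI[OF assms(1), where a = "i + 2"]) (auto simp: hd_last_upto)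
  then show ?thesis by (rule has_cycleI) simp
qed

text \<open>Otherwise no vertex can be skipped, so all distance-2 chords have the other colour;
  applied to the cycle they form, the same argument returns the distance-4 chords to the first
  colour.\<close>

lemma odd_mono_cycle_descend:
  assumes sym: "symp E" and cyc: "cycle_map E V L v" and L: "odd L" "L \<ge> 7"
  shows "has_mono_cycle E V (nat (L - 1))"
proof (rule ccontr)
  assume no: "\<not> has_mono_cycle E V (nat (L - 1))"
  have step2: "\<not> E (v i) (v (i + 2))" for i
    using cycle_map_skip_vertex[OF cyc, of i] no L by (auto simp: has_mono_cycle_def)
  \<comment> \<open>As \<open>L\<close> is odd, doubling permutes the residues modulo
    \<open>L\<close>, so the distance-2 chords form a single cycle of length
    \<open>L\<close>.\<close>
  have "cycle_map (\<lambda>x y. \<not> E x y) V L (\<lambda>i. v (2 * i))"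
  proof -
    have "(2 * i) mod L = (2 * j) mod L \<longleftrightarrow> i mod L = j mod L" for i j
    proof -
      have "coprime L 2" using L by simp
      then have "L dvd 2 * (i - j) \<longleftrightarrow> L dvd i - j" by (rule coprime_dvd_mult_right_iff)
      then show ?thesis by (simp only: mod_eq_dvd_iff right_diff_distrib)
    qed
    moreover have "\<not> E (v (2 * i)) (v (2 * (i + 1)))" for i
      using step2[of "2 * i"] by (simp add: algebra_simps)
    ultimately show ?thesis
      using cyc unfolding cycle_map_def by auto
  qed
  then have step4: "E (v (2 * i)) (v (2 * i + 4))" for i
    using cycle_map_skip_vertex[of "\<lambda>x y. \<not> E x y" V L _ i] no L
    by (force simp: has_mono_cycle_def algebra_simps)
  \<comment> \<open>So far only even indices are covered; adding the odd period makes an odd index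
    even.\<close>
  have step4: "E (v i) (v (i + 4))" for i
  proof (cases "even i")
    case True
    then show ?thesis using step4 by (metis evenE)
  next
    case False
    then have "even (i + L)" using L by simp
    then have "E (v (i + L)) (v (i + L + 4))" using step4 by (metis evenE)
    then show ?thesis
      using cycle_map_add_period[OF cyc, of i] cycle_map_add_period[OF cyc, of "i + 4"]
      by (simp add: algebra_simps)
  qed
  have E1: "E (v (L - 3)) (v 1)" "E (v 2) (v (L - 2))" "E (v (L - 1)) (v 3)"
    using step4[of "L - 3"] step4[of "L - 2"] step4[of "L - 1"] symp_commute[OF sym, of "v (L - 2)" "v 2"]
      cycle_map_add_period[OF cyc, of 1] cycle_map_add_period[OF cyc, of 2]
      cycle_map_add_period[OF cyc, of 3]
    by (auto simp: algebra_simps)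
  \<comment> \<open>Index 0 is omitted; the jumps \<open>L - 3\<close> to 1, 2 to
    \<open>L - 2\<close> and \<open>L - 1\<close> to 3 are distance-4 chords modulo
    \<open>L\<close>.\<close>
  have "cycle_in E V (map v ([3..L - 3] @ [1, 2, L - 2, L - 1]))"
    using L E1 cycle_map_arc[OF cyc] cycle_map_step[OF cyc, of 1] cycle_map_step[OF cyc, of "L - 2"]
    by (intro cycle_in_mapI[OF cyc, where a = 0])
      (auto simp: hd_last_upto successively_append_iff hd_append upto_Nil)
  then have "has_cycle E V (nat (L - 1))"
    using L by (auto intro!: has_cycleI)
  then show False using no by (simp add: has_mono_cycle_def)
qed

text \<open>Two skippable vertices that are not consecutive could be skipped together. Hence nearly
  all distance-2 chords, and all distance-3 chords, have the other colour, and these contain a cycle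
  of the same length \<open>2 * k - 2\<close>.\<close>

lemma even_mono_cycle_descend:
  assumes sym: "symp E" and cyc: "cycle_map E V (2 * k) v" and k: "k \<ge> 3"
  shows "has_mono_cycle E V (nat (2 * k - 2))"
proof (rule ccontr)
  assume no: "\<not> has_mono_cycle E V (nat (2 * k - 2))"
  define T where "T = {p. E (v (p - 1)) (v (p + 1))}"
  have per: "v (i + 2 * k) = v i" for i using cycle_map_add_period[OF cyc] by simp
  have T: "q = p + 1 \<or> q = p + 2 * k - 1" if "p \<in> T" "q \<in> T" "p < q" "q < p + 2 * k" for p q
  proof (rule ccontr)
    assume "\<not> ?thesis"
    then have pq: "p + 1 \<le> q - 1" "q + 1 \<le> p + 2 * k - 1" using that by auto
    have "v (p + 2 * k - 1) = v (p - 1)" using per[of "p - 1"] by (simp add: algebra_simps)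
    then have "cycle_in E V (map v ([p + 1..q - 1] @ [q + 1..p + 2 * k - 1]))"
      using that pq cycle_map_arc[OF cyc]
      by (intro cycle_in_mapI[OF cyc, where a = "p + 1"])
        (auto simp: hd_last_upto successively_append_iff upto_Nil T_def hd_append last_append)
    moreover have "length (map v ([p + 1..q - 1] @ [q + 1..p + 2 * k - 1])) = nat (2 * k - 2)"
      using that pq by simp
    ultimately show False
      using no by (auto simp: has_mono_cycle_def has_cycle_def)
  qed
  \<comment> \<open>Modulo \<open>2 * k\<close>, all of \<open>T\<close> lies in two consecutive
    positions \<open>p\<close> and \<open>p + 1\<close>; three mutually consecutive positions cannot
    exist as \<open>k \<ge> 3\<close>.\<close>
  have "\<exists>p. \<forall>q. p + 2 \<le> q \<longrightarrow> q < p + 2 * k \<longrightarrow> q \<notin> T"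
  proof (cases "T = {}")
    case False
    then obtain p where p: "p \<in> T" by blast
    show ?thesis
    proof (cases "p - 1 \<in> T")
      case True
      then show ?thesis
        using T[of "p - 1"] T[of p] p k by (intro exI[of _ "p - 1"]) force
    next
      case False
      then have "p - 1 + 2 * k \<notin> T"
        using per[of "p - 2"] per[of p] by (simp add: T_def algebra_simps)
      moreover have "q = p - 1 + 2 * k" if "q \<in> T" "p + 2 \<le> q" "q < p + 2 * k" for q
        using T[OF p that(1)] that by auto
      ultimately show ?thesis by blast
    qed
  qed auto
  then obtain p where p: "\<And>q. p + 2 \<le> q \<Longrightarrow> q < p + 2 * k \<Longrightarrow> q \<notin> T" by blast
  define w where "w = (\<lambda>i. v (i + p))"
  have cw: "cycle_map E V (2 * k) w"
    unfolding w_def using cyc by (rule cycle_map_shift)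
  have B2: "\<not> E (w i) (w (i + 2))" if "1 \<le> i" "i + 2 \<le> 2 * k" for i
    using p[of "i + 1 + p"] that by (auto simp: T_def w_def algebra_simps)
  have B3: "\<not> E (w i) (w (i + 3))" for i
  proof
    assume E: "E (w i) (w (i + 3))"
    have "cycle_in E V (map w [i + 3..i + 2 * k])"
      using k E cycle_map_arc[OF cw] cycle_map_add_period[OF cw]
      by (intro cycle_in_mapI[OF cw, where a = "i + 3"]) (auto simp: hd_last_upto)
    then show False
      using no by (auto simp: has_mono_cycle_def intro!: has_cycleI)
  qed
  let ?G = "\<lambda>x y. \<not> E x y"
  \<comment> \<open>Up the odd indices from 1 to \<open>2 * k - 3\<close>, then down the even ones
    from \<open>2 * k\<close> to 4. Indices 2 and \<open>2 * k - 1\<close> are omitted, and both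
    transitions are distance-3 chords.\<close>
  let ?is = "map (\<lambda>i. 2 * i + 1) [0..k - 2] @ map (\<lambda>i. 2 * (k - i)) [0..k - 2]"
  have s1: "successively (\<lambda>i j. ?G (w i) (w j)) (map (\<lambda>i. 2 * i + 1) [0..k - 2])"
    unfolding successively_map
  proof (intro successively_upto notI)
    fix i assume "0 \<le> i" "i < k - 2" "E (w (2 * i + 1)) (w (2 * (i + 1) + 1))"
    then show False using B2[of "2 * i + 1"] by (auto simp: algebra_simps)
  qed
  have s2: "successively (\<lambda>i j. ?G (w i) (w j)) (map (\<lambda>i. 2 * (k - i)) [0..k - 2])"
    unfolding successively_map
  proof (intro successively_upto notI)
    fix i assume "0 \<le> i" "i < k - 2" "E (w (2 * (k - i))) (w (2 * (k - (i + 1))))"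
    then show False
      using B2[of "2 * (k - (i + 1))"] symp_commute[OF sym, of "w (2 * (k - i))"]
      by (auto simp: algebra_simps)
  qed
  have m: "\<not> E (w (2 * k - 3)) (w (2 * k))" "\<not> E (w 4) (w 1)"
    using B3[of "2 * k - 3"] B3[of 1] symp_commute[OF sym, of "w 4"] by auto
  have ends: "2 * (k - 2) + 1 = 2 * k - 3" "2 * (k - (k - 2)) = 4" by auto
  have "cycle_in ?G V (map w ?is)"
  proof (rule cycle_in_mapI[OF cw, where a = 1])
    show "distinct ?is"
    proof -
      have "inj_on (\<lambda>i. 2 * i + 1) {0..k - 2}" "inj_on (\<lambda>i. 2 * (k - i)) {0..k - 2}"
        by (auto intro!: inj_onI)
      moreover have "2 * i + 1 \<noteq> 2 * (k - j)" for i j :: int by presburger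
      ultimately show ?thesis by (auto simp: distinct_map)
    qed
    show "successively (\<lambda>i j. ?G (w i) (w j)) ?is"
      using k s1 s2 m ends
      by (auto simp: successively_append_iff hd_map last_map hd_last_upto upto_Nil)
    show "?G (w (last ?is)) (w (hd ?is))"
      using k m ends by (simp add: hd_map last_map hd_last_upto upto_Nil hd_append last_append)
  qed (use k in \<open>auto simp: upto_Nil\<close>)
  then have "has_cycle ?G V (nat (2 * k - 2))"
    by (rule has_cycleI) (use k in simp)
  then show False using no by (simp add: has_mono_cycle_def)
qed

text \<open>Odd lengths drop by one and even lengths by two, so the descent cannot jump over
  \<open>2 * k\<close>. The colour may change at each step, hence the induction over
  \<open>has_mono_cycle\<close>.\<close>

lemma mono_cycle_descend:
  assumes sym: "symp E" and k: "k \<ge> 3" and "has_mono_cycle E V L" "L \<ge> 2 * k"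
  shows "has_mono_cycle E V (2 * k)"
  using assms(3,4)
proof (induction L rule: less_induct)
  case (less L)
  have *: "has_mono_cycle E V (2 * k)" if hc: "has_cycle G V L" and symG: "symp G"
    and G: "\<And>m. has_mono_cycle G V m \<Longrightarrow> has_mono_cycle E V m" for G
  proof (cases "L = 2 * k")
    case False
    obtain xs where xs: "cycle_in G V xs" "length xs = L" using hc by (auto simp: has_cycle_def)
    obtain v where v: "cycle_map G V (int L) v" using cycle_in_cycle_map[OF xs(1)] xs(2) by metis
    show ?thesis
    proof (cases "even L")
      case True
      then obtain j where j: "L = 2 * j" by (elim evenE)
      have "has_mono_cycle G V (nat (2 * int j - 2))"
        using even_mono_cycle_descend[of G V "int j" v] v j symG less.prems k by simp
      moreover have "nat (2 * int j - 2) = L - 2" using j by simp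
      ultimately show ?thesis
        using less.IH[of "L - 2"] G less.prems False j k by simp
    next
      case odd: False
      have "has_mono_cycle G V (nat (int L - 1))"
        using odd_mono_cycle_descend[of G V "int L" v] v symG less.prems False odd k by simp
      moreover have "nat (int L - 1) = L - 1" by simp
      ultimately show ?thesis
        using less.IH[of "L - 1"] G less.prems False k by simp
    qed
  qed (use G hc in \<open>auto simp: has_mono_cycle_def\<close>)
  show ?case
    using less.prems(1) *[of E] *[of "\<lambda>x y. \<not> E x y"] sym symp_neg[OF sym]
    by (auto simp: has_mono_cycle_def)
qed

section \<open>Odd cycles from monochromatic even cycles\<close>

lemma ex_distinct_list:
  assumes "finite A" "n \<le> card A"
  obtains xs where "distinct xs" "set xs \<subseteq> A" "length xs = n"
proof -
  obtain B where "B \<subseteq> A" "card B = n" "finite B"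
    using obtain_subset_with_card_n[OF assms(2)] by metis
  then show ?thesis using finite_distinct_list[of B] that by (metis distinct_card)
qed

lemma ex_distinct_list_ends:
  assumes "finite A" "n \<le> card A" "2 \<le> n" "a \<in> A" "b \<in> A" "a \<noteq> b"
  obtains xs where "distinct xs" "set xs \<subseteq> A" "length xs = n" "hd xs = a" "last xs = b"
proof -
  have c: "card (A - {a, b}) = card A - 2" using assms by (simp add: card_Diff_subset)
  obtain ys where "distinct ys" "set ys \<subseteq> A - {a, b}" "length ys = n - 2"
    by (rule ex_distinct_list[of "A - {a, b}" "n - 2"]) (use assms c in auto)
  then show ?thesis
    using assms by (intro that[of "a # ys @ [b]"]) auto
qed

lemma successively_clique:
  assumes "\<And>x y. x \<in> set xs \<Longrightarrow> y \<in> set xs \<Longrightarrow> x \<noteq> y \<Longrightarrow> E x y" "distinct xs"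
  shows "successively E xs"
  using assms by (auto simp: successively_conv_nth nth_eq_iff_index_eq)

text \<open>Consecutive elements of \<open>us\<close> are joined greedily through fresh vertices of \<open>D\<close>.\<close>
lemma zigzag_path:
  assumes "us \<noteq> []" "distinct us" "length us \<le> h + 1" "set us \<inter> D = {}" "finite D"
    and "\<And>x y. x \<in> set us \<Longrightarrow> y \<in> set us \<Longrightarrow> x \<noteq> y \<Longrightarrow> h \<le> card {w \<in> D. G x w \<and> G w y}"
  shows "\<exists>zs. zs \<noteq> [] \<and> hd zs = hd us \<and> last zs = last us \<and> distinct zs \<and> set zs \<subseteq> set us \<union> D \<and>
    length zs = 2 * length us - 1 \<and> successively G zs \<and> card (set zs \<inter> D) = length us - 1"
  using assms
proof (induction us)
  case (Cons u us)
  show ?case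
  proof (cases "us = []")
    case True
    then show ?thesis using Cons.prems by (intro exI[of _ "[u]"]) auto
  next
    case False
    have "\<exists>zs. zs \<noteq> [] \<and> hd zs = hd us \<and> last zs = last us \<and> distinct zs \<and> set zs \<subseteq> set us \<union> D \<and>
      length zs = 2 * length us - 1 \<and> successively G zs \<and> card (set zs \<inter> D) = length us - 1"
      using Cons.prems False by (intro Cons.IH) auto
    then obtain zs where zs: "zs \<noteq> []" "hd zs = hd us" "last zs = last us" "distinct zs"
      "set zs \<subseteq> set us \<union> D" "length zs = 2 * length us - 1" "successively G zs"
      "card (set zs \<inter> D) = length us - 1" by blast
    have h: "h \<le> card {w \<in> D. G u w \<and> G w (hd us)}"
      using Cons.prems False by (intro Cons.prems(6)) (auto simp: hd_in_set)
    \<comment> \<open>The tail has at most \<open>h\<close> elements and has used one connector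
      fewer than that, so one of the \<open>h\<close> candidates is still free.\<close>
    have "card (set zs \<inter> D) < card {w \<in> D. G u w \<and> G w (hd us)}"
      using h zs(8) Cons.prems(3) False by (cases us) auto
    then have "\<not> {w \<in> D. G u w \<and> G w (hd us)} \<subseteq> set zs \<inter> D"
      using card_mono[of "set zs \<inter> D"] by (meson List.finite_set finite_Int not_le)
    then obtain w where w: "w \<in> D" "G u w" "G w (hd us)" "w \<notin> set zs" by blast
    have "set (u # w # zs) \<inter> D = insert w (set zs \<inter> D)" using w(1) Cons.prems(4) by auto
    then have "card (set (u # w # zs) \<inter> D) = length us"
      using w zs(8) False by (cases us) auto
    moreover have "u \<notin> set zs" "u \<noteq> w" using zs(5) w(1) Cons.prems by auto
    ultimately show ?thesis
      using zs w Cons.prems False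
      by (intro exI[of _ "u # w # zs"]) (auto simp: successively_Cons)
  qed
qed simp

text \<open>An alternating path from \<open>p\<close> to \<open>p'\<close> has \<open>k\<close>
  vertices in \<open>P\<close> and \<open>k - 1\<close> in \<open>Q\<close>; the edge inside
  \<open>P\<close> closes it to an odd cycle.\<close>

lemma bipartite_plus_edge_cycle:
  assumes "finite P" "finite Q" "P \<inter> Q = {}" "P \<subseteq> V" "Q \<subseteq> V" "symp E"
    and "2 \<le> k" "k \<le> card P" "k - 1 \<le> card Q"
    and PQ: "\<And>x y. x \<in> P \<Longrightarrow> y \<in> Q \<Longrightarrow> E x y"
    and p: "p \<in> P" "p' \<in> P" "p \<noteq> p'" "E p p'"
  shows "has_cycle E V (2 * k - 1)"
proof -
  obtain us where us: "distinct us" "set us \<subseteq> P" "length us = k" "hd us = p" "last us = p'"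
    using ex_distinct_list_ends[of P k p p'] assms by metis
  have "\<exists>zs. zs \<noteq> [] \<and> hd zs = hd us \<and> last zs = last us \<and> distinct zs \<and> set zs \<subseteq> set us \<union> Q \<and>
      length zs = 2 * length us - 1 \<and> successively E zs \<and> card (set zs \<inter> Q) = length us - 1"
  proof (rule zigzag_path)
    show "k - 1 \<le> card {w \<in> Q. E x w \<and> E w y}" if "x \<in> set us" "y \<in> set us" for x y
    proof -
      have "{w \<in> Q. E x w \<and> E w y} = Q"
        using that us(2) PQ symp_commute[OF \<open>symp E\<close>] by blast
      then show ?thesis using assms by simp
    qed
  qed (use us assms in auto)
  then obtain zs where "zs \<noteq> []" "hd zs = p" "last zs = p'" "distinct zs" "set zs \<subseteq> set us \<union> Q"
      "length zs = 2 * k - 1" "successively E zs"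
    using us by auto
  moreover have "set zs \<subseteq> V" using calculation us assms by blast
  moreover have "E p' p" using p(4) symp_commute[OF \<open>symp E\<close>] by blast
  ultimately show ?thesis
    using us assms by (intro has_cycleI[of E V zs]) (auto simp: cycle_in_def)
qed

text \<open>An alternating path from \<open>p\<close> to \<open>q\<close> has
  \<open>2 * (k - 1)\<close> vertices, and \<open>u\<close> closes it to an odd cycle.\<close>

lemma bipartite_plus_vertex_cycle:
  assumes "finite P" "finite Q" "P \<inter> Q = {}" "P \<subseteq> V" "Q \<subseteq> V" "symp E"
    and "3 \<le> k" "k - 1 \<le> card P" "k - 1 \<le> card Q"
    and PQ: "\<And>x y. x \<in> P \<Longrightarrow> y \<in> Q \<Longrightarrow> E x y"
    and u: "u \<in> V" "u \<notin> P" "u \<notin> Q" "p \<in> P" "q \<in> Q" "E u p" "E u q"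
  shows "has_cycle E V (2 * k - 1)"
proof -
  have "card (P - {p}) = card P - 1" using assms by simp
  then have "\<not> card (P - {p}) = 0" using assms by simp
  then obtain p' where p': "p' \<in> P" "p \<noteq> p'" by (metis Diff_iff card.empty equals0I singletonI)
  obtain us where us: "distinct us" "set us \<subseteq> P" "length us = k - 1" "hd us = p" "last us = p'"
    by (rule ex_distinct_list_ends[of P "k - 1" p p']) (use assms p' in auto)
  \<comment> \<open>\<open>q\<close> is barred from the connectors so that it can be appended as the
    last vertex.\<close>
  have "\<exists>zs. zs \<noteq> [] \<and> hd zs = hd us \<and> last zs = last us \<and> distinct zs \<and>
      set zs \<subseteq> set us \<union> (Q - {q}) \<and> length zs = 2 * length us - 1 \<and> successively E zs \<and>
      card (set zs \<inter> (Q - {q})) = length us - 1"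
  proof (rule zigzag_path)
    show "k - 2 \<le> card {w \<in> Q - {q}. E x w \<and> E w y}" if "x \<in> set us" "y \<in> set us" for x y
    proof -
      have "{w \<in> Q - {q}. E x w \<and> E w y} = Q - {q}"
        using that us(2) PQ symp_commute[OF \<open>symp E\<close>] by blast
      then show ?thesis using assms by simp
    qed
  qed (use us assms in auto)
  then obtain zs where "zs \<noteq> []" "hd zs = p" "last zs = p'" "distinct zs"
      "set zs \<subseteq> set us \<union> (Q - {q})" "length zs = 2 * (k - 1) - 1" "successively E zs"
    using us by auto
  moreover have "E q u" "E p' q" using u PQ p' symp_commute[OF \<open>symp E\<close>] by blast+
  moreover have "set zs \<subseteq> V" using calculation us assms by blast
  moreover have "u \<notin> set zs" "q \<notin> set zs" "u \<noteq> q" using calculation us assms by auto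
  ultimately show ?thesis
    using us assms
    by (intro has_cycleI[of E V "u # zs @ [q]"])
      (auto simp: cycle_in_def successively_Cons successively_append_iff)
qed

text \<open>Each clique has a path of any desired number of vertices between prescribed ends:
  \<open>k\<close> in \<open>X\<close> and \<open>k - 1\<close> in \<open>Y\<close>, linked by the
  two cross edges.\<close>

lemma disjoint_cross_edges_cycle:
  assumes "finite X" "finite Y" "X \<inter> Y = {}" "X \<subseteq> V" "Y \<subseteq> V"
    and "3 \<le> k" "k \<le> card X" "k \<le> card Y"
    and "\<And>x y. x \<in> X \<Longrightarrow> y \<in> X \<Longrightarrow> x \<noteq> y \<Longrightarrow> G x y"
    and "\<And>x y. x \<in> Y \<Longrightarrow> y \<in> Y \<Longrightarrow> x \<noteq> y \<Longrightarrow> G x y"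
    and "x \<in> X" "x' \<in> X" "x \<noteq> x'" "y \<in> Y" "y' \<in> Y" "y \<noteq> y'" "G x y" "G y' x'"
  shows "has_cycle G V (2 * k - 1)"
proof -
  obtain xs where xs: "distinct xs" "set xs \<subseteq> X" "length xs = k" "hd xs = x'" "last xs = x"
    by (rule ex_distinct_list_ends[of X k x' x]) (use assms in auto)
  obtain ys where ys: "distinct ys" "set ys \<subseteq> Y" "length ys = k - 1" "hd ys = y" "last ys = y'"
    by (rule ex_distinct_list_ends[of Y "k - 1" y y']) (use assms in auto)
  have "successively G xs"
    by (rule successively_clique) (use xs assms(9) in blast)+
  moreover have "successively G ys"
    by (rule successively_clique) (use ys assms(10) in blast)+
  moreover have "xs \<noteq> []" "ys \<noteq> []" using xs ys assms by auto
  moreover have "set (xs @ ys) \<subseteq> V" "set xs \<inter> set ys = {}" using xs ys assms by auto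
  ultimately show ?thesis
    using xs ys assms
    by (intro has_cycleI[of G V "xs @ ys"]) (auto simp: cycle_in_def successively_append_iff)
qed

text \<open>Without \<open>x\<close>, the cliques are completely joined in the other colour
  \<open>?N\<close>. An outside vertex with \<open>?N\<close>-edges to both sides would close an odd
  \<open>?N\<close>-cycle, so \<open>U\<close> splits into vertices fully \<open>G\<close>-joined to
  \<open>Y\<close> and vertices fully \<open>G\<close>-joined to \<open>X - {x}\<close>; counting
  makes the second kind numerous.\<close>

lemma two_cliques_star:
  assumes fin: "finite X" "finite Y" "finite U" and disj: "X \<inter> Y = {}" "X \<inter> U = {}" "Y \<inter> U = {}"
    and V: "X \<subseteq> V" "Y \<subseteq> V" "U \<subseteq> V"
    and k: "3 \<le> k" "card X = k" "card Y = k" "2 * k - 3 \<le> card U" and sym: "symp G"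
    and cX: "\<And>x y. x \<in> X \<Longrightarrow> y \<in> X \<Longrightarrow> x \<noteq> y \<Longrightarrow> G x y"
    and cY: "\<And>x y. x \<in> Y \<Longrightarrow> y \<in> Y \<Longrightarrow> x \<noteq> y \<Longrightarrow> G x y"
    and xo: "x \<in> X" "o1 \<in> Y" "G x o1"
    and star: "\<And>x' y. x' \<in> X \<Longrightarrow> y \<in> Y \<Longrightarrow> G x' y \<Longrightarrow> x' = x"
  shows "has_mono_cycle G V (2 * k - 1)"
proof (rule ccontr)
  let ?N = "\<lambda>x y. \<not> G x y"
  assume "\<not> ?thesis"
  then have noG: "\<not> has_cycle G V (2 * k - 1)" and noN: "\<not> has_cycle ?N V (2 * k - 1)"
    by (auto simp: has_mono_cycle_def)
  define X' where "X' = X - {x}"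
  have X': "finite X'" "card X' = k - 1" "X' \<subseteq> X" "x \<notin> X'" using fin k xo by (auto simp: X'_def)
  have NXY: "?N a b" if "a \<in> X'" "b \<in> Y" for a b
    using star[of a b] that by (auto simp: X'_def)
  define U0 where "U0 = {u \<in> U. \<forall>y\<in>Y. G u y}"
  define U1 where "U1 = {u \<in> U. \<forall>y\<in>X'. G u y}"
  have fU: "finite U0" "finite U1" using fin by (auto simp: U0_def U1_def)
  have "U \<subseteq> U0 \<union> U1"
  proof
    fix u assume u: "u \<in> U"
    show "u \<in> U0 \<union> U1"
    proof (rule ccontr)
      assume "u \<notin> U0 \<union> U1"
      then obtain p q where pq: "p \<in> X'" "q \<in> Y" "?N u p" "?N u q"
        using u by (auto simp: U0_def U1_def)
      have "X' \<inter> Y = {}" "X' \<subseteq> V" "u \<in> V" "u \<notin> X'" "u \<notin> Y"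
        using u X'(3) disj V by blast+
      then have "has_cycle ?N V (2 * k - 1)"
        using bipartite_plus_vertex_cycle[of X' Y V ?N k u p q] pq X'(1,2) fin k V NXY symp_neg[OF sym]
        by simp
      then show False using noN by simp
    qed
  qed
  then have "card U \<le> card U0 + card U1"
    using fU by (meson card_Un_le card_mono finite_Un le_trans)
  \<comment> \<open>More such vertices would give a \<open>G\<close>-bipartite graph between
    \<open>Y\<close> and \<open>U0\<close>, with the clique edge \<open>o1 y\<close> to break
    parity.\<close>
  moreover have "card U0 \<le> k - 2"
  proof (rule ccontr)
    assume "\<not> ?thesis"
    then have c: "k - 1 \<le> card U0" by simp
    have "card (Y - {o1}) \<noteq> 0" using k xo fin by simp
    then obtain y where y: "y \<in> Y" "y \<noteq> o1" by (metis Diff_iff card.empty equals0I singletonI)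
    have "has_cycle G V (2 * k - 1)"
      by (rule bipartite_plus_edge_cycle[of Y U0 V G k o1 y])
        (use c y k fin disj V xo cY sym symp_commute[OF sym] in \<open>auto simp: U0_def\<close>)
    then show False using noG by simp
  qed
  ultimately have cU1: "k - 1 \<le> card U1" using k by linarith
  have fU1: "finite U1" "U1 \<subseteq> U" using fin by (auto simp: U1_def)
  \<comment> \<open>Such an edge closes the cycle through \<open>u\<close>, \<open>k - 2\<close>
    vertices of \<open>X'\<close>, then \<open>x\<close>, and \<open>k - 1\<close> vertices of
    \<open>Y\<close> from \<open>o1\<close> to \<open>y\<close>.\<close>
  have U1o: "?N u y" if u: "u \<in> U1" and y: "y \<in> Y" "y \<noteq> o1" for u y
  proof
    assume G: "G u y"
    obtain as where as: "distinct as" "set as \<subseteq> X'" "length as = k - 2"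
      by (rule ex_distinct_list[of X' "k - 2"]) (use X' in auto)
    obtain bs where bs: "distinct bs" "set bs \<subseteq> Y" "length bs = k - 1" "hd bs = o1" "last bs = y"
      by (rule ex_distinct_list_ends[of Y "k - 1" o1 y]) (use fin k xo y in auto)
    have ne: "as \<noteq> []" "bs \<noteq> []" using as bs k by auto
    have "hd as \<in> X'" "last as \<in> X'" using as(2) hd_in_set[OF ne(1)] last_in_set[OF ne(1)] by blast+
    then have "G u (hd as)" "G (last as) x" using u X' cX xo by (auto simp: U1_def)
    moreover have "successively G as"
      by (rule successively_clique) (use as X'(3) cX in blast)+
    moreover have "successively G bs"
      by (rule successively_clique) (use bs cY in blast)+
    moreover have "G y u" using G symp_commute[OF sym] by blast
    moreover have "set as \<inter> set bs = {}" "u \<notin> set as" "u \<notin> set bs" "u \<noteq> x" "x \<notin> set as" "x \<notin> set bs"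
      using as(2) bs(2) X'(3,4) u fU1(2) disj xo(1) by blast+
    moreover have "set as \<subseteq> V" "set bs \<subseteq> V" "u \<in> V" "x \<in> V"
      using as(2) bs(2) X'(3) u fU1(2) V xo(1) by blast+
    ultimately have "cycle_in G V (u # as @ x # bs)"
      using xo(3) ne as(1) bs(1,4,5)
      by (simp add: cycle_in_def successively_Cons successively_append_iff)
    then have "has_cycle G V (2 * k - 1)"
      by (rule has_cycleI) (use as bs k in auto)
    then show False using noG by simp
  qed
  have "card U1 \<noteq> 0" using cU1 k by simp
  then obtain u1 where u1: "u1 \<in> U1" by (metis card.empty equals0I)
  have "card (U1 - {u1}) \<noteq> 0" using cU1 k u1 fU1 by simp
  then obtain u2 where u2: "u2 \<in> U1" "u1 \<noteq> u2" by (metis Diff_iff card.empty equals0I singletonI)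
  \<comment> \<open>Whatever its colour, the edge \<open>u1 u2\<close> breaks parity in a complete
    bipartite graph of that colour: \<open>insert x U1\<close> against \<open>X'\<close> for
    \<open>G\<close>, and \<open>insert e U1\<close> with \<open>e\<close> in \<open>X'\<close>
    against \<open>Y - {o1}\<close> for \<open>?N\<close>.\<close>
  show False
  proof (cases "G u1 u2")
    case True
    have "insert x U1 \<inter> X' = {}" "insert x U1 \<subseteq> V" "X' \<subseteq> V" "x \<notin> U1"
      using X'(3,4) fU1(2) disj V xo(1) by blast+
    moreover have "card (insert x U1) = Suc (card U1)" using calculation(4) fU1(1) by simp
    moreover have "G a b" if "a \<in> insert x U1" "b \<in> X'" for a b
      using that X'(3,4) cX xo(1) by (auto simp: U1_def)
    ultimately have "has_cycle G V (2 * k - 1)"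
      using bipartite_plus_edge_cycle[of "insert x U1" X' V G k u1 u2]
        u1 u2 True cU1 X'(1,2) fU1(1) k(1) sym by simp
    then show False using noG by simp
  next
    case False
    have "card X' \<noteq> 0" using X' k by simp
    then obtain e where e: "e \<in> X'" by (metis card.empty equals0I)
    then have eU: "e \<notin> U1" using fU1 X' disj by auto
    have "insert e U1 \<inter> (Y - {o1}) = {}" "insert e U1 \<subseteq> V" "Y - {o1} \<subseteq> V"
      using X'(3) e fU1(2) disj V by blast+
    moreover have "card (insert e U1) = Suc (card U1)" using eU fU1(1) by simp
    moreover have "card (Y - {o1}) = k - 1" using fin xo(2) k by simp
    moreover have "?N a b" if "a \<in> insert e U1" "b \<in> Y - {o1}" for a b
      using that NXY[OF e] U1o by blast
    ultimately have "has_cycle ?N V (2 * k - 1)"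
      using bipartite_plus_edge_cycle[of "insert e U1" "Y - {o1}" V ?N k u1 u2]
        u1 u2 False cU1 fin(2) fU1(1) k(1) symp_neg[OF sym] by simp
    then show False using noN by simp
  qed
qed

text \<open>Cross edges of colour \<open>G\<close> meet pairwise, so they form a star centred in
  \<open>X\<close> or in \<open>Y\<close>, or there are none. With none, the splitting of
  \<open>U\<close> leaves \<open>k - 1\<close> vertices fully joined to one clique, which is enough
  for an odd cycle.\<close>

lemma two_cliques_mono_cycle:
  assumes fin: "finite X" "finite Y" "finite U" and disj: "X \<inter> Y = {}" "X \<inter> U = {}" "Y \<inter> U = {}"
    and V: "X \<subseteq> V" "Y \<subseteq> V" "U \<subseteq> V"
    and k: "3 \<le> k" "card X = k" "card Y = k" "2 * k - 3 \<le> card U" and sym: "symp G"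
    and cX: "\<And>x y. x \<in> X \<Longrightarrow> y \<in> X \<Longrightarrow> x \<noteq> y \<Longrightarrow> G x y"
    and cY: "\<And>x y. x \<in> Y \<Longrightarrow> y \<in> Y \<Longrightarrow> x \<noteq> y \<Longrightarrow> G x y"
  shows "has_mono_cycle G V (2 * k - 1)"
proof (rule ccontr)
  let ?N = "\<lambda>x y. \<not> G x y"
  assume no: "\<not> ?thesis"
  then have noG: "\<not> has_cycle G V (2 * k - 1)" and noN: "\<not> has_cycle ?N V (2 * k - 1)"
    by (auto simp: has_mono_cycle_def)
  have nocross: "x = x' \<or> y = y'" if "x \<in> X" "x' \<in> X" "y \<in> Y" "y' \<in> Y" "G x y" "G x' y'" for x x' y y'
  proof (rule ccontr)
    assume "\<not> ?thesis"
    then have "has_cycle G V (2 * k - 1)"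
      using symp_commute[OF sym, of x' y'] that
      by (intro disjoint_cross_edges_cycle[of X Y V k G x x' y y']) (use assms in auto)
    then show False using noG by simp
  qed
  show False
  proof (cases "\<exists>x\<in>X. \<exists>y\<in>Y. G x y")
    case True
    then obtain x y where xy: "x \<in> X" "y \<in> Y" "G x y" by blast
    \<comment> \<open>Pairwise meeting edges of a bipartite graph share a vertex, as no triangle is
      possible.\<close>
    have "(\<forall>x'\<in>X. \<forall>y'\<in>Y. G x' y' \<longrightarrow> x' = x) \<or> (\<forall>x'\<in>X. \<forall>y'\<in>Y. G x' y' \<longrightarrow> y' = y)"
      using nocross xy by metis
    then show False
    proof
      assume "\<forall>x'\<in>X. \<forall>y'\<in>Y. G x' y' \<longrightarrow> x' = x"
      then show False
        using two_cliques_star[of X Y U V k G x y] assms xy no by blast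
    next
      assume "\<forall>x'\<in>X. \<forall>y'\<in>Y. G x' y' \<longrightarrow> y' = y"
      then have "\<And>x' y'. x' \<in> Y \<Longrightarrow> y' \<in> X \<Longrightarrow> G x' y' \<Longrightarrow> x' = y"
        using symp_commute[OF sym] by blast
      moreover have "Y \<inter> X = {}" "G y x" using disj xy symp_commute[OF sym] by blast+
      ultimately show False
        using two_cliques_star[of Y X U V k G y x] assms xy no by blast
    qed
  next
    case False
    define U0 where "U0 = {u \<in> U. \<forall>y\<in>Y. G u y}"
    define U1 where "U1 = {u \<in> U. \<forall>y\<in>X. G u y}"
    have fU: "finite U0" "finite U1" "U0 \<subseteq> U" "U1 \<subseteq> U" using fin by (auto simp: U0_def U1_def)
    have "U \<subseteq> U0 \<union> U1"
    proof
      fix u assume u: "u \<in> U"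
      show "u \<in> U0 \<union> U1"
      proof (rule ccontr)
        assume "u \<notin> U0 \<union> U1"
        then obtain p q where pq: "p \<in> X" "q \<in> Y" "?N u p" "?N u q"
          using u by (auto simp: U0_def U1_def)
        have "has_cycle ?N V (2 * k - 1)"
          by (rule bipartite_plus_vertex_cycle[of X Y V ?N k u p q])
            (use u pq fin k disj V False symp_neg[OF sym] in auto)
        then show False using noN by simp
      qed
    qed
    then have "card U \<le> card U0 + card U1"
      using fU by (meson card_Un_le card_mono finite_Un le_trans)
    then have "k - 1 \<le> card U0 \<or> k - 1 \<le> card U1" using k by linarith
    then show False
    proof
      assume c: "k - 1 \<le> card U0"
      obtain as where as: "distinct as" "set as \<subseteq> Y" "length as = 2"
        by (rule ex_distinct_list[of Y 2]) (use fin k in auto)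
      then obtain a b where ab: "a \<in> Y" "b \<in> Y" "a \<noteq> b" by (auto simp: length_Suc_conv numeral_2_eq_2)
      have "has_cycle G V (2 * k - 1)"
        by (rule bipartite_plus_edge_cycle[of Y U0 V G k a b])
          (use c ab k fin fU disj V cY sym symp_commute[OF sym] in \<open>auto simp: U0_def\<close>)
      then show False using noG by simp
    next
      assume c: "k - 1 \<le> card U1"
      obtain as where as: "distinct as" "set as \<subseteq> X" "length as = 2"
        by (rule ex_distinct_list[of X 2]) (use fin k in auto)
      then obtain a b where ab: "a \<in> X" "b \<in> X" "a \<noteq> b" by (auto simp: length_Suc_conv numeral_2_eq_2)
      have "has_cycle G V (2 * k - 1)"
        by (rule bipartite_plus_edge_cycle[of X U1 V G k a b])
          (use c ab k fin fU disj V cX sym symp_commute[OF sym] in \<open>auto simp: U1_def\<close>)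
      then show False using noG by simp
    qed
  qed
qed

lemma successively_map_upto:
  "(\<And>i. a \<le> i \<Longrightarrow> i < b \<Longrightarrow> P (f i) (f (i + 1))) \<Longrightarrow> successively P (map f [a..b])"
  unfolding successively_map by (rule successively_upto)

text \<open>Distance-2 chords are blue, since no vertex can be skipped. A longer red even chord from
  0 to \<open>2 * t\<close> forces two further blue chords, and together these give a blue cycle
  missing only \<open>2 * t\<close>.\<close>

lemma even_cycle_even_chord:
  assumes sym: "symp E" and cyc: "cycle_map E V (2 * k) v"
    and no: "\<not> has_mono_cycle E V (nat (2 * k - 1))"
    and t: "1 \<le> t" "t \<le> k - 1"
  shows "\<not> E (v i) (v (i + 2 * t))"
proof
  assume chord: "E (v i) (v (i + 2 * t))"
  let ?N = "\<lambda>x y. \<not> E x y"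
  have k: "k \<ge> 2" using t by linarith
  define w where "w = (\<lambda>j. v (j + i))"
  have cw: "cycle_map E V (2 * k) w" unfolding w_def using cyc by (rule cycle_map_shift)
  have per: "w (j + 2 * k) = w j" for j using cycle_map_add_period[OF cw] by simp
  have E0: "E (w 0) (w (2 * t))" using chord by (simp add: w_def algebra_simps)
  have noE: "\<not> has_cycle E V (nat (2 * k - 1))" and noN: "\<not> has_cycle ?N V (nat (2 * k - 1))"
    using no by (auto simp: has_mono_cycle_def)
  have N2: "?N (w j) (w (j + 2))" for j
    using cycle_map_skip_vertex[OF cw, of j] noE k by auto
  have N2': "?N (w (j + 2)) (w j)" for j
    using N2[of j] symp_commute[OF sym] by blast
  have "t \<noteq> 1" using N2[of 0] E0 by auto
  moreover have "t \<noteq> k - 1"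
  proof
    assume "t = k - 1"
    then have "2 * t + 2 = 0 + 2 * k" by simp
    then have "w 0 = w (2 * t + 2)" using per[of 0] by metis
    then show False using N2'[of "2 * t"] E0 by simp
  qed
  ultimately have t2: "2 \<le> t" "t \<le> k - 2" using t by auto
  \<comment> \<open>If red, this chord would give with the assumed one a red cycle that misses only
    \<open>2 * t + 1\<close>.\<close>
  have A: "?N (w 1) (w (2 * t + 2))"
  proof
    assume E1: "E (w 1) (w (2 * t + 2))"
    let ?is = "0 # rev [1..2 * t] @ [2 * t + 2..2 * k - 1]"
    have "E (w (2 * k - 1)) (w 0)" using cycle_map_step[OF cw, of "2 * k - 1"] per[of 0] by simp
    then have "cycle_in E V (map w ?is)"
      using t2 E0 E1 cycle_map_arc[OF cw] cycle_map_rev_arc[OF cw sym]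
      by (intro cycle_in_mapI[OF cw, where a = 0])
        (auto simp: successively_Cons successively_append_iff hd_append last_append hd_last_upto hd_rev last_rev
           simp del: successively_rev)
    then show False using noE t2 by (auto simp: has_cycle_def)
  qed
  \<comment> \<open>Likewise with a red cycle that misses only \<open>2 * t - 1\<close>.\<close>
  have B: "?N (w (2 * k - 1)) (w (2 * t - 2))"
  proof
    assume E1: "E (w (2 * k - 1)) (w (2 * t - 2))"
    let ?is = "[0..2 * t - 2] @ rev [2 * t..2 * k - 1]"
    have "E (w (2 * t)) (w 0)" "E (w (2 * t - 2)) (w (2 * k - 1))"
      using E0 E1 symp_commute[OF sym] by blast+
    then have "cycle_in E V (map w ?is)"
      using t2 cycle_map_arc[OF cw] cycle_map_rev_arc[OF cw sym]
      by (intro cycle_in_mapI[OF cw, where a = 0])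
        (auto simp: successively_Cons successively_append_iff hd_append last_append hd_last_upto hd_rev last_rev
           simp del: successively_rev)
    then show False using noE t2 by (auto simp: has_cycle_def)
  qed
  \<comment> \<open>The blue cycle runs up all odd indices, down from \<open>2 * t - 2\<close> to 0,
    and down from \<open>2 * k - 2\<close> to \<open>2 * t + 2\<close>. \<open>B\<close> enters the
    even part, a distance-2 chord leads from 0 to \<open>2 * k - 2\<close>, and \<open>A\<close>
    returns to 1.\<close>
  let ?odd = "map (\<lambda>j. 2 * j + 1) [0..k - 1]"
  let ?ev1 = "map (\<lambda>j. 2 * (t - 1 - j)) [0..t - 1]"
  let ?ev2 = "map (\<lambda>j. 2 * (k - 1 - j)) [0..k - t - 2]"
  have "successively (\<lambda>i j. ?N (w i) (w j)) ?odd"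
  proof (intro successively_map_upto)
    fix j show "?N (w (2 * j + 1)) (w (2 * (j + 1) + 1))"
      using N2[of "2 * j + 1"] by (simp add: algebra_simps)
  qed
  moreover have "successively (\<lambda>i j. ?N (w i) (w j)) ?ev1"
  proof (intro successively_map_upto)
    fix j show "?N (w (2 * (t - 1 - j))) (w (2 * (t - 1 - (j + 1))))"
      using N2'[of "2 * (t - 1 - (j + 1))"] by (simp add: algebra_simps)
  qed
  moreover have "successively (\<lambda>i j. ?N (w i) (w j)) ?ev2"
  proof (intro successively_map_upto)
    fix j show "?N (w (2 * (k - 1 - j))) (w (2 * (k - 1 - (j + 1))))"
      using N2'[of "2 * (k - 1 - (j + 1))"] by (simp add: algebra_simps)
  qed
  moreover have "?N (w 0) (w (2 * k - 2))" using N2'[of "2 * k - 2"] per[of 0] by simp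
  moreover have "?N (w (2 * t + 2)) (w 1)" using A symp_commute[OF sym] by blast
  moreover have ends: "hd ?odd = 1" "last ?odd = 2 * k - 1" "hd ?ev1 = 2 * t - 2" "last ?ev1 = 0"
    "hd ?ev2 = 2 * k - 2" "last ?ev2 = 2 * t + 2" "?odd \<noteq> []" "?ev1 \<noteq> []" "?ev2 \<noteq> []"
    using t2 by (simp_all add: hd_map last_map hd_last_upto)
  ultimately have succ: "successively (\<lambda>i j. ?N (w i) (w j)) (?odd @ ?ev1 @ ?ev2)"
    and close: "?N (w (last (?odd @ ?ev1 @ ?ev2))) (w (hd (?odd @ ?ev1 @ ?ev2)))"
    using B by (simp_all only: successively_append_iff hd_append2 last_append append_is_Nil_conv if_False if_True)
      simp_all
  have dist: "distinct (?odd @ ?ev1 @ ?ev2)"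
    by (auto simp: distinct_map inj_on_def; presburger)
  have "cycle_in ?N V (map w (?odd @ ?ev1 @ ?ev2))"
    by (rule cycle_in_mapI[OF cw, where a = 0, OF _ dist _ succ close]) (use t2 in auto)
  then have "has_cycle ?N V (nat (2 * k - 1))"
    by (rule has_cycleI) (use t2 in auto)
  then show False using noN by simp
qed

lemma even_mono_cycle_to_odd:
  assumes sym: "symp E" and cyc: "has_mono_cycle E V (2 * k)" and k: "3 \<le> k"
    and V: "finite V" "4 * k - 3 \<le> card V"
  shows "has_mono_cycle E V (2 * k - 1)"
proof -
  have *: "has_mono_cycle G V (2 * k - 1)" if hc: "has_cycle G V (2 * k)" and symG: "symp G" for G
  proof (rule ccontr)
    assume no: "\<not> ?thesis"
    let ?N = "\<lambda>x y. \<not> G x y"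
    obtain xs where xs: "cycle_in G V xs" "length xs = 2 * k" using hc by (auto simp: has_cycle_def)
    obtain v where v: "cycle_map G V (int (length xs)) v" using cycle_in_cycle_map[OF xs(1)] .
    then have v: "cycle_map G V (2 * int k) v" using xs(2) by simp
    have no': "\<not> has_mono_cycle G V (nat (2 * int k - 1))" 
    proof -
      have "nat (2 * int k - 1) = 2 * k - 1" using k by linarith
      then show ?thesis using no by simp
    qed
    define X where "X = (\<lambda>i. v (2 * i)) ` {0..<int k}"
    define Y where "Y = (\<lambda>i. v (2 * i + 1)) ` {0..<int k}"
    have inj: "i = j" if "v i = v j" "i \<in> {0..<2 * int k}" "j \<in> {0..<2 * int k}" for i j
      using cycle_map_inj_window[OF v that(1), of 0] that by auto
    have chord: "?N (v (a + 2 * i)) (v (a + 2 * j))" if "0 \<le> i" "i < int k" "0 \<le> j" "j < int k" "i \<noteq> j" for a i j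
    proof (cases "i < j")
      case True
      then show ?thesis
        using even_cycle_even_chord[OF symG v no', of "j - i" "a + 2 * i"] that by (simp add: algebra_simps)
    next
      case False
      then have "?N (v (a + 2 * j)) (v (a + 2 * i))"
        using even_cycle_even_chord[OF symG v no', of "i - j" "a + 2 * j"] that by (simp add: algebra_simps)
      then show ?thesis using symp_commute[OF symG] by blast
    qed
    have cX: "?N x y" if "x \<in> X" "y \<in> X" "x \<noteq> y" for x y
      using that chord[of _ _ 0] by (force simp: X_def)
    have cY: "?N x y" if "x \<in> Y" "y \<in> Y" "x \<noteq> y" for x y
      using that chord[of _ _ 1] by (force simp: Y_def add.commute)
    have "inj_on (\<lambda>i. v (2 * i)) {0..<int k}" "inj_on (\<lambda>i. v (2 * i + 1)) {0..<int k}"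
      by (auto intro!: inj_onI dest!: inj)
    then have card: "card X = k" "card Y = k" by (simp_all add: X_def Y_def card_image)
    have "2 * i \<noteq> 2 * j + 1" for i j :: int by presburger
    then have disj: "X \<inter> Y = {}" by (auto simp: X_def Y_def dest!: inj)
    have sub: "X \<subseteq> V" "Y \<subseteq> V" using v by (auto simp: X_def Y_def cycle_map_def)
    \<comment> \<open>This is where \<open>4 * k - 3\<close> comes from: \<open>2 * k - 3\<close>
      vertices must remain outside the two cliques.\<close>
    have "card (V - (X \<union> Y)) = card V - 2 * k"
      using V sub card disj by (simp add: card_Diff_subset card_Un_disjoint finite_subset)
    then have "has_mono_cycle ?N V (2 * k - 1)"
      using V sub disj k card cX cY symp_neg[OF symG]
      by (intro two_cliques_mono_cycle[of X Y "V - (X \<union> Y)"]) (auto intro: finite_subset)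
    then show False using no by (simp add: has_mono_cycle_neg)
  qed
  then show ?thesis
    using cyc *[of E] *[of "\<lambda>x y. \<not> E x y"] sym symp_neg[OF sym]
    by (auto simp: has_mono_cycle_def)
qed

subsection \<open>Cycles in dense graphs\<close>

text \<open>Dirac's theorem, by rotating a longest path: both ends have all their neighbours on it,
  so two crossing chords close it to a cycle on the same vertices.\<close>

lemma dirac_hamiltonian:
  assumes V: "finite V" "3 \<le> card V" and sym: "symp E"
    and deg: "\<And>x. x \<in> V \<Longrightarrow> card V \<le> 2 * card {y \<in> V - {x}. E x y}"
  shows "has_cycle E V (card V)"
proof -
  define P where "P = {p. p \<noteq> [] \<and> distinct p \<and> set p \<subseteq> V \<and> successively E p}"
  have bound: "length p \<le> card V" if "p \<in> P" for p
    using that V by (auto simp: P_def intro: card_mono simp flip: distinct_card)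
  obtain x0 where "x0 \<in> V" using V by (metis card.empty equals0I not_numeral_le_zero)
  then have "[x0] \<in> P" by (auto simp: P_def)
  then obtain p where p: "p \<in> P" and max: "\<And>q. q \<in> P \<Longrightarrow> length q \<le> length p"
    using ex_has_greatest_nat[of "\<lambda>p. p \<in> P" "[x0]" length "card V + 1"] bound by (metis le_imp_less_Suc Suc_eq_plus1)
  have pP: "p \<noteq> []" "distinct p" "set p \<subseteq> V" "successively E p" using p by (auto simp: P_def)
  define l where "l = length p"
  have nbr_hd: "y \<in> set p" if "y \<in> V" "E (hd p) y" for y
  proof (rule ccontr)
    assume "y \<notin> set p"
    then have "y # p \<in> P" using pP that symp_commute[OF sym, of y] by (auto simp: P_def successively_Cons)
    then show False using max by force
  qed
  have nbr_last: "y \<in> set p" if "y \<in> V" "E (last p) y" for y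
  proof (rule ccontr)
    assume "y \<notin> set p"
    then have "p @ [y] \<in> P" using pP that by (auto simp: P_def successively_append_iff)
    then show False using max by force
  qed
  \<comment> \<open>Both index sets have at least \<open>card V / 2\<close> elements among only
    \<open>l - 1\<close> positions, so they share some \<open>i\<close>. Then the edge from
    \<open>p ! i\<close> to its successor can be replaced by edges to the two ends.\<close>
  define A where "A = {i. i < l - 1 \<and> E (hd p) (p ! Suc i)}"
  define B where "B = {i. i < l - 1 \<and> E (last p) (p ! i)}"
  have "{y \<in> V - {hd p}. E (hd p) y} \<subseteq> (\<lambda>i. p ! Suc i) ` A"
  proof
    fix y assume y: "y \<in> {y \<in> V - {hd p}. E (hd p) y}"
    then obtain j where j: "j < l" "y = p ! j" using nbr_hd by (auto simp: in_set_conv_nth l_def)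
    moreover have "j \<noteq> 0" using y j pP by (cases j) (auto simp: hd_conv_nth)
    ultimately show "y \<in> (\<lambda>i. p ! Suc i) ` A"
      using y by (intro image_eqI[of _ _ "j - 1"]) (auto simp: A_def)
  qed
  then have "card {y \<in> V - {hd p}. E (hd p) y} \<le> card A"
    by (rule surj_card_le[rotated]) (simp add: A_def)
  then have cA: "card V \<le> 2 * card A" using deg[of "hd p"] pP by force
  have "{y \<in> V - {last p}. E (last p) y} \<subseteq> (\<lambda>i. p ! i) ` B"
  proof
    fix y assume y: "y \<in> {y \<in> V - {last p}. E (last p) y}"
    then obtain j where j: "j < l" "y = p ! j" using nbr_last by (auto simp: in_set_conv_nth l_def)
    moreover have "j \<noteq> l - 1" using y j pP by (auto simp: last_conv_nth l_def)
    ultimately show "y \<in> (\<lambda>i. p ! i) ` B"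
      using y by (intro image_eqI[of _ _ j]) (auto simp: B_def)
  qed
  then have "card {y \<in> V - {last p}. E (last p) y} \<le> card B"
    by (rule surj_card_le[rotated]) (simp add: B_def)
  then have cB: "card V \<le> 2 * card B" using deg[of "last p"] pP by force
  have "card (A \<union> B) \<le> l - 1"
    using card_mono[of "{..<l - 1}" "A \<union> B"] by (auto simp: A_def B_def)
  moreover have "l \<le> card V" using bound[OF p] by (simp add: l_def)
  moreover have "card (A \<union> B) + card (A \<inter> B) = card A + card B"
    by (rule card_Un_Int[symmetric]) (auto simp: A_def B_def)
  ultimately have "card (A \<inter> B) \<noteq> 0" using cA cB V by linarith
  then obtain i where i: "i < l - 1" "E (hd p) (p ! Suc i)" "E (last p) (p ! i)"
    by (metis (no_types, lifting) A_def B_def Int_iff card.empty equals0I mem_Collect_eq)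
  define c where "c = take (Suc i) p @ rev (drop (Suc i) p)"
  have il: "Suc i < length p" using i by (simp add: l_def)
  have "successively E (take (Suc i) p)" "successively E (drop (Suc i) p)"
    using pP(4) append_take_drop_id[of "Suc i" p] successively_append_iff[of E] by metis+
  moreover have "hd (rev (drop (Suc i) p)) = last p" "last (rev (drop (Suc i) p)) = p ! Suc i"
    "last (take (Suc i) p) = p ! i" "hd (take (Suc i) p) = hd p"
    using il pP(1)
    by (auto simp: hd_rev last_rev hd_drop_conv_nth last_drop take_Suc_conv_app_nth[of i p] hd_append hd_take
        hd_conv_nth)
  moreover have "E (p ! i) (last p)" "E (p ! Suc i) (hd p)" using i symp_commute[OF sym] by blast+
  moreover have "set c = set p"
    unfolding c_def by (metis append_take_drop_id set_append set_rev)
  moreover have "length c = l" using il by (simp add: c_def l_def)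
  moreover have "distinct c"
    using pP(2) set_take_disj_set_drop_if_distinct[OF pP(2), of "Suc i" "Suc i"] by (simp add: c_def)
  ultimately have c: "cycle_in E V c" "length c = l" "set c = set p"
    using il pP unfolding cycle_in_def c_def
    by (auto simp: successively_append_iff successively_rev_sym[OF sym] simp del: successively_rev)
  have "l = card V"
  proof (rule ccontr)
    assume "l \<noteq> card V"
    then have lt: "l < card V" using bound[OF p] by (simp add: l_def)
    have cp: "card (set p) = l" using pP by (simp add: distinct_card l_def)
    obtain y where y: "y \<in> V" "y \<notin> set p" using lt cp pP V by (metis card_mono not_le subsetI List.finite_set)
    \<comment> \<open>The bound on \<open>A\<close> shows that the path covers more than half of
      \<open>V\<close>, so too few vertices remain for all neighbours of \<open>y\<close>. A
      neighbour on the cycle lets \<open>y\<close> extend it, cut open there, to a longer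
      path.\<close>
    have "\<exists>z\<in>set p. E y z"
    proof (rule ccontr)
      assume "\<not> ?thesis"
      then have "{x \<in> V - {y}. E y x} \<subseteq> V - insert y (set p)" by auto
      then have "card {x \<in> V - {y}. E y x} \<le> card V - Suc l"
        using card_mono[of "V - insert y (set p)"] V pP y cp by (simp add: card_Diff_subset)
      moreover have "card A \<le> l - 1"
        using card_mono[of "{..<l - 1}" A] by (auto simp: A_def)
      ultimately show False using deg[OF y(1)] cA lt V by linarith
    qed
    then obtain z where z: "z \<in> set p" "E y z" by blast
    obtain v where v: "cycle_map E V (int l) v" "range v = set p"
      using cycle_in_cycle_map[OF c(1)] c(2,3) by metis
    then obtain j where j: "z = v j" using z by blast
    have l: "l > 0" using pP by (simp add: l_def)
    have inj: "inj_on v {j..<j + int l}"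
      using cycle_map_inj_window[OF v(1), of _ _ j] by (auto intro!: inj_onI)
    have "{j..j + int l - 1} = {j..<j + int l}" by auto
    then have "y # map v [j..j + int l - 1] \<in> P"
      using y z j v l inj cycle_map_arc[OF v(1)] pP
      by (auto simp: P_def successively_Cons successively_map hd_map hd_last_upto distinct_map)
    then show False using max[of "y # map v [j..j + int l - 1]"] by (simp add: l_def)
  qed
  then show ?thesis using c by (auto simp: has_cycle_def)
qed

text \<open>Deleting \<open>x\<close> leaves a Hamiltonian graph on \<open>2 * r\<close> vertices.
  As \<open>x\<close> sees more than half of the Hamiltonian cycle, it sees two vertices at distance
  \<open>m - 2\<close> along it, and the arc between them closes through \<open>x\<close>.\<close>

lemma dense_pancyclic:
  assumes V: "finite V" "card V = 2 * r + 1" and r: "2 \<le> r" and sym: "symp E"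
    and deg: "\<And>x. x \<in> V \<Longrightarrow> r + 1 \<le> card {y \<in> V - {x}. E x y}"
    and m: "3 \<le> m" "m \<le> 2 * r"
  shows "has_cycle E V m"
proof -
  obtain x where x: "x \<in> V" using V by (metis card.empty equals0I add_is_0 one_neq_zero)
  let ?W = "V - {x}"
  have W: "finite ?W" "card ?W = 2 * r" using V x by auto
  have "has_cycle E ?W (card ?W)"
  proof (rule dirac_hamiltonian)
    fix y assume y: "y \<in> ?W"
    have "{z \<in> V - {y}. E y z} \<subseteq> insert x {z \<in> ?W - {y}. E y z}" by auto
    then have "card {z \<in> V - {y}. E y z} \<le> card (insert x {z \<in> ?W - {y}. E y z})"
      using V by (intro card_mono) auto
    also have "\<dots> = Suc (card {z \<in> ?W - {y}. E y z})"
      using V by (intro card_insert_disjoint) auto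
    finally have "card {z \<in> V - {y}. E y z} \<le> Suc (card {z \<in> ?W - {y}. E y z})" .
    then show "card ?W \<le> 2 * card {z \<in> ?W - {y}. E y z}" using deg[of y] y W by auto
  qed (use W r sym in auto)
  then obtain xs where xs: "cycle_in E ?W xs" "length xs = 2 * r" using W by (auto simp: has_cycle_def)
  obtain v where v: "cycle_map E ?W (int (2 * r)) v" "range v = set xs"
    using cycle_in_cycle_map[OF xs(1)] xs(2) by metis
  define L where "L = int (2 * r)"
  have vL: "cycle_map E ?W L v" using v by (simp add: L_def)
  have "set xs = ?W"
    using xs W by (intro card_subset_eq) (auto simp: cycle_in_def distinct_card)
  then have ran: "?W = v ` {0..<L}" using cycle_map_card(1)[OF vL] v(2) by simp
  define S where "S = {i \<in> {0..<L}. E x (v i)}"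
  define T where "T = {i \<in> {0..<L}. E x (v (i + int m - 2))}"
  have fin: "finite S" "finite T" and ST: "S \<union> T \<subseteq> {0..<L}"
    by (auto simp: S_def T_def intro: finite_subset[of _ "{0..<L}"])
  have "{y \<in> V - {x}. E x y} \<subseteq> v ` S" using ran by (auto simp: S_def)
  then have "card {y \<in> V - {x}. E x y} \<le> card S"
    by (rule surj_card_le[rotated]) (rule fin)
  then have S: "r + 1 \<le> card S" using deg[OF x] by linarith
  have "{y \<in> V - {x}. E x y} \<subseteq> (\<lambda>i. v (i + int m - 2)) ` T"
  proof
    fix y assume y: "y \<in> {y \<in> V - {x}. E x y}"
    then obtain i where i: "y = v i" using ran by blast
    let ?j = "(i + 2 - int m) mod L"
    have "(?j + (int m - 2)) mod L = (i + 2 - int m + (int m - 2)) mod L" by (rule mod_add_left_eq)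
    then have "(?j + int m - 2) mod L = i mod L" by (simp add: add_diff_eq)
    then have "v (?j + int m - 2) = y" using vL i by (simp add: cycle_map_def)
    moreover have "?j \<in> {0..<L}" using r by (simp add: L_def)
    ultimately show "y \<in> (\<lambda>i. v (i + int m - 2)) ` T"
      using y by (intro image_eqI[of _ _ ?j]) (auto simp: T_def)
  qed
  then have "card {y \<in> V - {x}. E x y} \<le> card T"
    by (rule surj_card_le[rotated]) (rule fin)
  then have T: "r + 1 \<le> card T" using deg[OF x] by linarith
  have "card (S \<union> T) \<le> 2 * r"
    using card_mono[OF _ ST] by (simp add: L_def)
  moreover have "card (S \<union> T) + card (S \<inter> T) = card S + card T"
    by (rule card_Un_Int[symmetric]) (rule fin)+
  ultimately have "card (S \<inter> T) \<noteq> 0" using S T by linarith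
  then obtain i where i: "E x (v i)" "E x (v (i + int m - 2))"
    by (metis (no_types, lifting) S_def T_def Int_iff card.empty equals0I mem_Collect_eq)
  have inj: "inj_on v {i..i + int m - 2}"
    using cycle_map_inj_window[OF vL, of _ _ i] m by (auto intro!: inj_onI simp: L_def)
  have sub: "range v \<subseteq> ?W" using vL by (simp add: cycle_map_def)
  have "E (v (i + int m - 2)) x" using i symp_commute[OF sym] by blast
  then have "cycle_in E V (x # map v [i..i + int m - 2])"
    using i m x inj sub cycle_map_arc[OF vL]
    by (auto simp: cycle_in_def successively_Cons successively_map hd_map last_map hd_last_upto distinct_map)
  then show ?thesis by (rule has_cycleI) (use m in auto)
qed

subsection \<open>Long monochromatic cycles\<close>

lemma card_le_filter_add: "card A \<le> card {x \<in> A. P x} + card {x \<in> A. \<not> P x}"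
proof -
  have "A = {x \<in> A. P x} \<union> {x \<in> A. \<not> P x}" by blast
  then have "card A = card ({x \<in> A. P x} \<union> {x \<in> A. \<not> P x})" by (rule arg_cong)
  also have "\<dots> \<le> card {x \<in> A. P x} + card {x \<in> A. \<not> P x}" by (rule card_Un_le)
  finally show ?thesis .
qed

text \<open>A vertex \<open>v\<close> has four neighbours \<open>B\<close> in one colour. Any other
  vertex has at most one neighbour of that colour in \<open>B\<close>, so two further vertices share
  two neighbours of the other colour there.\<close>

lemma mono_cycle_4:
  assumes V: "finite V" "8 \<le> card V" and sym: "symp E"
  shows "has_mono_cycle E V 4"
proof (rule ccontr)
  assume no: "\<not> ?thesis"
  obtain v where v: "v \<in> V" using V by (metis card.empty equals0I not_numeral_le_zero)
  have "card (V - {v}) \<le> card {y \<in> V - {v}. E v y} + card {y \<in> V - {v}. \<not> E v y}"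
    by (rule card_le_filter_add)
  moreover have "card (V - {v}) = card V - 1" using V v by simp
  ultimately have big: "4 \<le> card {y \<in> V - {v}. E v y} \<or> 4 \<le> card {y \<in> V - {v}. \<not> E v y}"
    using V by linarith
  have *: False if deg: "4 \<le> card {y \<in> V - {v}. G v y}" and symG: "symp G"
    and noG: "\<not> has_cycle G V 4" and noN: "\<not> has_cycle (\<lambda>x y. \<not> G x y) V 4" for G
  proof -
    obtain B where B: "B \<subseteq> {y \<in> V - {v}. G v y}" "card B = 4" "finite B"
      using obtain_subset_with_card_n[OF deg] by metis
    have BV: "B \<subseteq> V" "v \<notin> B" "\<And>y. y \<in> B \<Longrightarrow> G v y" using B by auto
    have "card (V - insert v B) \<ge> 2" using V B BV v by (simp add: card_Diff_subset)
    then obtain xs where xs: "distinct xs" "set xs \<subseteq> V - insert v B" "length xs = 2"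
      using ex_distinct_list[of "V - insert v B" 2] V by blast
    then obtain x y where xy: "x \<in> V" "y \<in> V" "x \<noteq> y" "x \<noteq> v" "y \<noteq> v" "x \<notin> B" "y \<notin> B"
      by (auto simp: length_Suc_conv numeral_2_eq_2)
    have one: "card {b \<in> B. G z b} \<le> Suc 0" if z: "z \<in> V" "z \<noteq> v" "z \<notin> B" for z
    proof (rule ccontr)
      assume "\<not> ?thesis"
      then obtain a b where ab: "a \<in> B" "b \<in> B" "a \<noteq> b" "G z a" "G z b"
        using B by (auto simp: card_le_Suc0_iff_eq)
      have "cycle_in G V [v, a, z, b]"
        using ab z v BV symp_commute[OF symG, of a z] symp_commute[OF symG, of b v]
        by (auto simp: cycle_in_def)
      then show False using noG by (auto simp: has_cycle_def)
    qed
    have "B = {b \<in> B. G x b} \<union> {b \<in> B. G y b} \<union> {b \<in> B. \<not> G x b \<and> \<not> G y b}" by blast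
    then have "card B = card ({b \<in> B. G x b} \<union> {b \<in> B. G y b} \<union> {b \<in> B. \<not> G x b \<and> \<not> G y b})"
      by (rule arg_cong)
    also have "\<dots> \<le> card ({b \<in> B. G x b} \<union> {b \<in> B. G y b}) + card {b \<in> B. \<not> G x b \<and> \<not> G y b}"
      by (rule card_Un_le)
    finally have "card B \<le> \<dots>" .
    moreover have "card ({b \<in> B. G x b} \<union> {b \<in> B. G y b}) \<le> card {b \<in> B. G x b} + card {b \<in> B. G y b}"
      by (rule card_Un_le)
    ultimately have "\<not> card {b \<in> B. \<not> G x b \<and> \<not> G y b} \<le> Suc 0"
      using one[of x] one[of y] xy B by simp
    then obtain a b where ab: "a \<in> B" "b \<in> B" "a \<noteq> b" "\<not> G x a" "\<not> G x b" "\<not> G y a" "\<not> G y b"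
      using B by (auto simp: card_le_Suc0_iff_eq)
    have "cycle_in (\<lambda>x y. \<not> G x y) V [x, a, y, b]"
      using ab xy BV symp_commute[OF symG, of a y] symp_commute[OF symG, of b x]
      by (auto simp: cycle_in_def)
    then show False using noN by (auto simp: has_cycle_def)
  qed
  show False
    using big *[of E] *[of "\<lambda>x y. \<not> E x y"] sym symp_neg[OF sym] no
    by (auto simp: has_mono_cycle_def)
qed

section \<open>Vertices outside a longest monochromatic cycle\<close>

locale longest_cycle =
  fixes E :: "'a \<Rightarrow> 'a \<Rightarrow> bool" and V :: "'a set" and L :: int and v :: "int \<Rightarrow> 'a"
  assumes finV: "finite V" and sym: "symp E" and cyc: "cycle_map E V L v" and L4: "L \<ge> 4"
    and longest: "\<And>m. int m > L \<Longrightarrow> \<not> has_mono_cycle E V m"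
begin

definition C :: "'a set" where "C = range v"
definition U :: "'a set" where "U = V - C"
definition R :: "'a \<Rightarrow> 'a set" where "R a = {w \<in> C. E a w}"
text \<open>The available connectors between \<open>a\<close> and \<open>b\<close> in a blue path
  that alternates between \<open>U\<close> and the cycle.\<close>

definition F :: "'a \<Rightarrow> 'a \<Rightarrow> 'a set" where "F a b = {w \<in> C. \<not> E a w \<and> \<not> E w b}"

lemma C_sub: "C \<subseteq> V" and finC: "finite C" and finU: "finite U" and cardC: "card C = nat L"
  and disjUC: "U \<inter> C = {}"
  using cyc finV cycle_map_card(2)[OF cyc] finite_subset
  by (auto simp: C_def U_def cycle_map_def)

lemma F_conv: "F a b = C - (R a \<union> R b)"
  using symp_commute[OF sym] by (auto simp: F_def R_def)

lemma card_F: "card (F a b) + card (R a \<union> R b) = nat L"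
proof -
  have "R a \<union> R b \<subseteq> C" by (auto simp: R_def)
  then have "card (R a \<union> R b) \<le> card C" "card (F a b) = card C - card (R a \<union> R b)"
    using finC finite_subset unfolding F_conv by (blast intro: card_mono card_Diff_subset)+
  then show ?thesis using cardC by linarith
qed

lemma no_long_cycle:
  assumes "cycle_in G V xs" "int (length xs) > L" "G = E \<or> G = (\<lambda>x y. \<not> E x y)"
  shows False
  using assms longest[of "length xs"] by (auto simp: has_mono_cycle_def has_cycle_def)

text \<open>The path would replace the \<open>d - 1\<close> inner vertices of an arc by at least
  \<open>d\<close> vertices.\<close>

lemma no_insertion:
  assumes p: "p \<noteq> []" "distinct p" "set p \<subseteq> U" "successively E p"
    and d: "1 \<le> d" "d \<le> int (length p)" "d < L"
    and ends: "E (hd p) (v i)" "E (last p) (v (i + d))"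
  shows False
proof -
  have "set (map v [i + d..i + L]) \<inter> set p = {}" "set p \<subseteq> V" "range v \<subseteq> V"
    using p C_sub by (auto simp: U_def C_def)
  moreover have "inj_on v {i + d..i + L}"
    using cycle_map_inj_window[OF cyc, of _ _ "i + d"] d by (auto intro!: inj_onI)
  moreover have "E (v i) (hd p)" using ends symp_commute[OF sym] by blast
  ultimately have "cycle_in E V (map v [i + d..i + L] @ p)"
    using p d ends cycle_map_arc[OF cyc] cycle_map_add_period[OF cyc, of i]
    by (auto simp: cycle_in_def successively_append_iff successively_map last_map hd_map hd_last_upto distinct_map)
  moreover have "int (length (map v [i + d..i + L] @ p)) > L" using d by simp
  ultimately show False using no_long_cycle by blast
qed

text \<open>Otherwise \<open>a\<close>, the arc from \<open>j\<close> back to \<open>i + 1\<close>,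
  \<open>b\<close>, and the arc from \<open>j + 1\<close> on to \<open>i + L\<close> form a cycle of
  length \<open>L + 2\<close>.\<close>

lemma no_double_insertion:
  assumes ab: "a \<in> U" "b \<in> U" "a \<noteq> b"
    and ij: "E a (v i)" "E a (v j)" "E b (v (i + 1))" "E b (v (j + 1))" "v i \<noteq> v j"
  shows False
proof -
  define j' where "j' = i + (j - i) mod L"
  have mod: "(j' + c) mod L = (j + c) mod L" for c
  proof -
    have "(i + c + (j - i) mod L) mod L = (i + c + (j - i)) mod L" by (rule mod_add_right_eq)
    then show ?thesis by (simp add: j'_def algebra_simps)
  qed
  then have v: "v (j' + c) = v (j + c)" for c using cyc by (simp add: cycle_map_def)
  have v0: "v j' = v j" using v[of 0] by simp
  have "0 \<le> (j - i) mod L" "(j - i) mod L < L" using L4 by auto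
  moreover have "j' \<noteq> i" using v0 ij(5) by auto
  ultimately have j': "i < j'" "j' < i + L" by (auto simp: j'_def)
  let ?xs = "a # map v (rev [i + 1..j']) @ b # map v [j' + 1..i + L]"
  have "set (rev [i + 1..j'] @ [j' + 1..i + L]) \<subseteq> {i + 1..<i + 1 + L}" using j' by auto
  moreover have "inj_on v {i + 1..<i + 1 + L}"
    using cycle_map_inj_window[OF cyc, of _ _ "i + 1"] by (auto intro!: inj_onI)
  ultimately have "inj_on v (set (rev [i + 1..j'] @ [j' + 1..i + L]))"
    by (rule inj_on_subset[rotated])
  then have "distinct (map v (rev [i + 1..j'] @ [j' + 1..i + L]))"
    by (subst distinct_map) auto
  moreover have "a \<notin> range v" "b \<notin> range v" "a \<in> V" "b \<in> V" "range v \<subseteq> V"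
    using ab C_sub by (auto simp: U_def C_def)
  ultimately have "distinct ?xs" "set ?xs \<subseteq> V" using ab(3) by auto
  moreover have "E a (v j')" "E b (v (j' + 1))" using ij v0 v[of 1] by simp_all
  moreover have "E (v (i + 1)) b" "E (v (i + L)) a"
    using ij symp_commute[OF sym] cycle_map_add_period[OF cyc, of i] by metis+
  moreover have "successively E (rev (map v [i + 1..j']))"
    using cycle_map_rev_arc[OF cyc sym] by (simp only: rev_map successively_map)
  ultimately have "cycle_in E V ?xs"
    using j' cycle_map_arc[OF cyc]
    by (auto simp: cycle_in_def successively_Cons successively_append_iff successively_map last_map hd_map
        hd_last_upto hd_rev last_rev simp del: successively_rev rev_map simp flip: rev_map)
  moreover have "int (length ?xs) > L" using j' by simp
  ultimately show False using no_long_cycle by blast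
qed

definition shift :: "'a set \<Rightarrow> 'a set" where "shift A = {v (i + 1) | i. v i \<in> A}"

lemma v_eq_iff: "v i = v j \<longleftrightarrow> i mod L = j mod L"
  using cyc by (simp add: cycle_map_def)

lemma v_Suc_eq_iff: "v (i + 1) = v (j + 1) \<longleftrightarrow> v i = v j"
  by (simp add: v_eq_iff mod_eq_dvd_iff)

lemma mem_shift_iff: "v (i + 1) \<in> shift A \<longleftrightarrow> v i \<in> A"
  by (auto simp: shift_def v_Suc_eq_iff)

lemma card_shift:
  assumes "A \<subseteq> C"
  shows "shift A \<subseteq> C" "card (shift A) = card A"
proof -
  show "shift A \<subseteq> C" by (auto simp: shift_def C_def)
  \<comment> \<open>The choice of index is harmless: \<open>v (i + 1)\<close> depends only on
    \<open>v i\<close>.\<close>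
  define f where "f w = v ((SOME i. v i = w) + 1)" for w
  have f: "f (v i) = v (i + 1)" for i
    unfolding f_def v_Suc_eq_iff by (rule someI) simp
  have "shift A = f ` A"
  proof
    show "shift A \<subseteq> f ` A" by (auto simp: shift_def simp flip: f)
    show "f ` A \<subseteq> shift A"
    proof
      fix y assume "y \<in> f ` A"
      then obtain w where "w \<in> A" "y = f w" by blast
      moreover obtain i where "w = v i" using assms \<open>w \<in> A\<close> by (auto simp: C_def)
      ultimately show "y \<in> shift A" by (auto simp: shift_def f)
    qed
  qed
  moreover have "inj_on f A"
  proof (rule inj_onI)
    fix x y assume xy: "x \<in> A" "y \<in> A" "f x = f y"
    then obtain i where "x = v i" using assms unfolding C_def by blast
    moreover obtain j where "y = v j" using xy assms unfolding C_def by blast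
    ultimately show "x = y" using xy by (simp add: f v_Suc_eq_iff)
  qed
  ultimately show "card (shift A) = card A" by (simp add: card_image)
qed

lemma R_sub: "R a \<subseteq> C" by (auto simp: R_def)

lemma v_mem_R: "v i \<in> R a \<longleftrightarrow> E a (v i)" by (auto simp: R_def C_def)

lemma R_independent: "a \<in> U \<Longrightarrow> v i \<in> R a \<Longrightarrow> v (i + 1) \<notin> R a"
  using no_insertion[of "[a]" 1 i] L4 by (auto simp: v_mem_R)

text \<open>Consecutive cycle vertices in the union must belong to different outside vertices by
  \<open>R_independent\<close>, and each of the two orders occurs at most once by
  \<open>no_double_insertion\<close>. So the union meets its shift in at most 2 vertices.\<close>

lemma card_R_Un:
  assumes ab: "a \<in> U" "b \<in> U" "a \<noteq> b"
  shows "2 * card (R a \<union> R b) \<le> nat L + 2"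
proof -
  let ?S = "R a \<union> R b"
  have S: "?S \<subseteq> C" "finite ?S" using R_sub finC by (auto intro: finite_subset)
  have fs: "finite (shift ?S)" using card_shift(1)[OF S(1)] finC finite_subset by blast
  have cross: "card (shift (R x) \<inter> R y) \<le> 1" if xy: "x \<in> U" "y \<in> U" "x \<noteq> y" for x y
  proof -
    have "w = w'" if ww: "w \<in> shift (R x) \<inter> R y" "w' \<in> shift (R x) \<inter> R y" for w w'
    proof (rule ccontr)
      assume "w \<noteq> w'"
      obtain i where i: "w = v (i + 1)" "v i \<in> R x" using ww by (auto simp: shift_def)
      obtain j where j: "w' = v (j + 1)" "v j \<in> R x" using ww by (auto simp: shift_def)
      show False
        using no_double_insertion[OF xy, of i j] i j ww \<open>w \<noteq> w'\<close> by (simp add: v_mem_R v_Suc_eq_iff)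
    qed
    moreover have "finite (shift (R x) \<inter> R y)" using R_sub finC finite_subset by blast
    ultimately show ?thesis using card_le_Suc0_iff_eq by (metis One_nat_def)
  qed
  have "?S \<inter> shift ?S \<subseteq> (shift (R a) \<inter> R b) \<union> (shift (R b) \<inter> R a)"
  proof
    fix w assume w: "w \<in> ?S \<inter> shift ?S"
    then obtain i where i: "w = v (i + 1)" "v i \<in> ?S" by (auto simp: shift_def)
    then show "w \<in> (shift (R a) \<inter> R b) \<union> (shift (R b) \<inter> R a)"
      using w R_independent[of _ i] ab by (auto simp: mem_shift_iff)
  qed
  then have "card (?S \<inter> shift ?S) \<le> card ((shift (R a) \<inter> R b) \<union> (shift (R b) \<inter> R a))"
    using S R_sub finC finite_subset by (intro card_mono) blast+
  also have "\<dots> \<le> 2"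
    using cross[of a b] cross[of b a] ab card_Un_le[of "shift (R a) \<inter> R b" "shift (R b) \<inter> R a"] by simp
  finally have "card (?S \<inter> shift ?S) \<le> 2" .
  moreover have "card (?S \<union> shift ?S) \<le> nat L"
    using S card_shift(1)[OF S(1)] finC cardC by (metis card_mono Un_least)
  moreover have "card (?S \<union> shift ?S) + card (?S \<inter> shift ?S) = 2 * card ?S"
    using card_Un_Int[OF S(2) fs] card_shift(2)[OF S(1)] by simp
  ultimately show ?thesis by linarith
qed

lemma blue_zigzag:
  assumes us: "us \<noteq> []" "distinct us" "set us \<subseteq> U" "length us \<le> h + 1"
    and F: "\<And>a b. a \<in> U \<Longrightarrow> b \<in> U \<Longrightarrow> a \<noteq> b \<Longrightarrow> h \<le> card (F a b \<inter> D)" and D: "D \<subseteq> C"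
  obtains zs where "zs \<noteq> []" "hd zs = hd us" "last zs = last us" "distinct zs" "set zs \<subseteq> set us \<union> D"
    "length zs = 2 * length us - 1" "successively (\<lambda>x y. \<not> E x y) zs" "card (set zs \<inter> D) = length us - 1"
proof -
  have "\<exists>zs. zs \<noteq> [] \<and> hd zs = hd us \<and> last zs = last us \<and> distinct zs \<and> set zs \<subseteq> set us \<union> D \<and>
    length zs = 2 * length us - 1 \<and> successively (\<lambda>x y. \<not> E x y) zs \<and> card (set zs \<inter> D) = length us - 1"
  proof (rule zigzag_path[OF us(1,2,4)])
    show "set us \<inter> D = {}" "finite D" using us D disjUC finC finite_subset by blast+
    fix x y assume "x \<in> set us" "y \<in> set us" "x \<noteq> y"
    moreover have "F x y \<inter> D = {w \<in> D. \<not> E x w \<and> \<not> E w y}" using D by (auto simp: F_def)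
    ultimately show "h \<le> card {w \<in> D. \<not> E x w \<and> \<not> E w y}" using F[of x y] us(3) by auto
  qed
  then show ?thesis using that by blast
qed

lemma ex_U_list:
  assumes "finite X" "X \<subseteq> U" "2 \<le> n" "n + card X \<le> card U" "a \<in> U - X" "b \<in> U - X" "a \<noteq> b"
  obtains us where "distinct us" "set us \<subseteq> U - X" "length us = n" "hd us = a" "last us = b" "us \<noteq> []"
proof -
  have "card (U - X) = card U - card X" using assms by (simp add: card_Diff_subset)
  then have n: "n \<le> card (U - X)" using assms by linarith
  have "finite (U - X)" using finU by simp
  then obtain us where "distinct us" "set us \<subseteq> U - X" "length us = n" "hd us = a" "last us = b"
    using ex_distinct_list_ends[OF _ n assms(3,5,6,7)] by blast
  moreover from this have "us \<noteq> []" using assms(3) by auto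
  ultimately show ?thesis using that by blast
qed

lemma UC_V: "x \<in> U \<Longrightarrow> x \<in> V" "x \<in> C \<Longrightarrow> x \<in> V"
  using C_sub by (auto simp: U_def)

lemma F_commute: "F a b = F b a"
  by (auto simp: F_conv)

lemma F_sub: "F a b \<subseteq> C"
  by (auto simp: F_def)

lemma ex_F_avoiding:
  assumes "finite X" "card X < card (F a b)"
  obtains w where "w \<in> F a b" "w \<notin> X"
  using assms card_mono[of X "F a b"] by (meson not_le subsetI)

section \<open>A longest cycle of odd length\<close>

lemma odd_closing:
  assumes L: "L = 2 * int s - 1" "3 \<le> s" "s \<le> card U"
    and abc: "a \<in> U" "b \<in> U" "c \<in> U" "a \<noteq> b" "a \<noteq> c" "b \<noteq> c"
    and w: "w \<in> F a b" "s - 1 \<le> card (F c a - {w})"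
  shows False
proof -
  have nL: "nat L = 2 * s - 1" using L by linarith
  \<comment> \<open>A blue zigzag from \<open>b\<close> to \<open>c\<close> with
    \<open>2 * s - 3\<close> vertices, avoiding \<open>a\<close> and \<open>w\<close>, is closed
    through \<open>w'\<close>, \<open>a\<close>, \<open>w\<close> to length \<open>2 * s\<close>,
    one more than \<open>L\<close>.\<close>
  obtain us where us: "distinct us" "set us \<subseteq> U - {a}" "length us = s - 1" "hd us = b" "last us = c" "us \<noteq> []"
    by (rule ex_U_list[of "{a}" "s - 1" b c]) (use abc L in auto)
  have Fh: "s - 2 \<le> card (F x y \<inter> (C - {w}))" if "x \<in> U" "y \<in> U" "x \<noteq> y" for x y
  proof -
    have "s - 1 \<le> card (F x y)" using card_R_Un[OF that] card_F[of x y] nL by linarith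
    moreover have "F x y \<inter> (C - {w}) = F x y - {w}" using F_sub by blast
    moreover have "card (F x y) - 1 \<le> card (F x y - {w})" by (simp add: card_Diff_singleton_if)
    ultimately show ?thesis by simp
  qed
  have "length us \<le> s - 2 + 1" "set us \<subseteq> U" "C - {w} \<subseteq> C" using us(2,3) by auto
  then obtain zs where zs: "zs \<noteq> []" "hd zs = hd us" "last zs = last us" "distinct zs"
    "set zs \<subseteq> set us \<union> (C - {w})" "length zs = 2 * length us - 1" "successively (\<lambda>x y. \<not> E x y) zs"
    "card (set zs \<inter> (C - {w})) = length us - 1"
    using blue_zigzag[OF us(6,1) _ _ Fh] by blast
  note zs = zs[unfolded us(3-5)]
  have "\<not> F c a - {w} \<subseteq> set zs \<inter> (C - {w})"
    using card_mono[of "set zs \<inter> (C - {w})" "F c a - {w}"] zs(8) w(2) L by auto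
  then obtain w' where w': "w' \<in> F c a" "w' \<noteq> w" "w' \<notin> set zs" using F_sub by blast
  have "w \<notin> set zs" "a \<notin> set zs" "a \<noteq> w" "a \<noteq> w'"
    using zs(5) us(2) abc w(1) w'(1) F_sub disjUC by blast+
  moreover have "set zs \<subseteq> V" "w \<in> V" "w' \<in> V" "a \<in> V"
    using zs(5) us(2) abc w(1) w'(1) F_sub UC_V by blast+
  ultimately have "cycle_in (\<lambda>x y. \<not> E x y) V (zs @ [w', a, w])"
    using zs w w' by (auto simp: cycle_in_def successively_append_iff F_def)
  then show False using no_long_cycle[of _ "zs @ [w', a, w]"] zs(6) L by auto
qed

text \<open>By \<open>odd_closing\<close>, the sets \<open>F\<close> agree on all pairs from three
  outside vertices and have at most \<open>s - 1\<close> elements. Their complement on the cycle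
  then contains two consecutive vertices, each red to at least two of the three, hence a common one,
  against \<open>R_independent\<close>.\<close>

lemma odd_impossible:
  assumes L: "L = 2 * int s - 1" "3 \<le> s" "s \<le> card U"
  shows False
proof -
  have nL: "nat L = 2 * s - 1" using L by linarith
  have sub: "F a b \<subseteq> F a c"
    if "a \<in> U" "b \<in> U" "c \<in> U" "a \<noteq> b" "a \<noteq> c" "b \<noteq> c" for a b c
  proof
    fix w assume w: "w \<in> F a b"
    show "w \<in> F a c"
    proof (rule ccontr)
      assume "w \<notin> F a c"
      then have "F c a - {w} = F c a" using F_commute by blast
      moreover have "s - 1 \<le> card (F c a)" using card_R_Un[OF that(3,1) that(5)[symmetric]] card_F[of c a] nL by linarith
      ultimately show False using odd_closing[OF L that w] by simp
    qed
  qed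
  obtain xs where "distinct xs" "set xs \<subseteq> U" "length xs = 3"
    using ex_distinct_list[OF finU, of 3] L by auto
  then obtain a b c where abc: "a \<in> U" "b \<in> U" "c \<in> U" "a \<noteq> b" "a \<noteq> c" "b \<noteq> c"
    by (auto simp: length_Suc_conv numeral_3_eq_3)
  have eq: "F a b = F a c" "F b c = F a b"
    using sub[of a b c] sub[of a c b] sub[of b a c] sub[of b c a] abc F_commute by (metis subset_antisym)+
  let ?S = "R a \<union> R b"
  have S: "?S \<subseteq> C" "R a \<union> R c = ?S" "R b \<union> R c = ?S"
    using eq R_sub unfolding F_conv by blast+
  have "card (F a b) \<le> s - 1"
  proof (rule ccontr)
    assume big: "\<not> ?thesis"
    then have "F a b \<noteq> {}" by auto
    then obtain w where w: "w \<in> F a b" by blast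
    have "s - 1 \<le> card (F c a - {w})"
    proof -
      have "F c a = F a b" using eq F_commute by blast
      then have "s \<le> card (F c a)" using big by simp
      moreover have "card (F c a) - 1 \<le> card (F c a - {w})" by (simp add: card_Diff_singleton_if)
      ultimately show ?thesis by linarith
    qed
    then show False using odd_closing[OF L abc w] by blast
  qed
  then have "s \<le> card ?S" using card_F[of a b] nL L by linarith
  moreover have "?S \<inter> shift ?S = {} \<Longrightarrow> 2 * card ?S \<le> nat L"
    using card_shift[OF S(1)] S(1) finC cardC
    by (metis card_Un_disjoint card_mono finite_subset Un_least mult_2)
  ultimately have "?S \<inter> shift ?S \<noteq> {}" using nL L by linarith
  then obtain i where "v i \<in> ?S" "v (i + 1) \<in> ?S" by (auto simp: shift_def)
  then show False
    using S(2,3) R_independent[of a i] R_independent[of b i] R_independent[of c i] abc by blast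
qed

section \<open>A longest cycle of even length\<close>

definition tight :: "'a \<Rightarrow> 'a \<Rightarrow> bool" where
  "tight a b \<longleftrightarrow> (\<forall>i. (v i \<in> R a \<longrightarrow> v (i + 1) \<notin> R b \<and> v (i + 2) \<notin> R b) \<and>
    (v i \<in> R b \<longrightarrow> v (i + 1) \<notin> R a \<and> v (i + 2) \<notin> R a))"

lemma tight_commute: "tight a b \<longleftrightarrow> tight b a"
  by (auto simp: tight_def)

text \<open>A red outside path with at least two vertices can be inserted into arcs of length 1 and
  2; its reversal covers the symmetric half.\<close>

lemma tightI:
  assumes p: "distinct p" "set p \<subseteq> U" "successively E p" "2 \<le> length p" "hd p = a" "last p = b"
  shows "tight a b"
proof -
  have ne: "p \<noteq> []" using p by auto
  have rev: "successively E (rev p)" using p(3) successively_rev_sym[OF sym] by blast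
  show ?thesis
    unfolding tight_def v_mem_R
    using no_insertion[OF ne p(1,2,3), of 1] no_insertion[OF ne p(1,2,3), of 2]
      no_insertion[of "rev p" 1] no_insertion[of "rev p" 2] p ne rev L4
    by (auto simp: hd_rev last_rev simp del: successively_rev)
qed

lemma tight_disjoint_shift:
  assumes "a \<in> U" "b \<in> U" "tight a b"
  shows "(R a \<union> R b) \<inter> shift (R a \<union> R b) = {}"
  using assms R_independent[of a] R_independent[of b] by (auto simp: shift_def tight_def)

text \<open>The union is disjoint from its shift. In the extremal case the two fill the cycle, so
  membership alternates.\<close>

lemma card_R_tight:
  assumes ab: "a \<in> U" "b \<in> U" "tight a b"
  shows "2 * card (R a \<union> R b) \<le> nat L"
    and "2 * card (R a \<union> R b) = nat L \<Longrightarrow> v i \<in> R a \<union> R b \<longleftrightarrow> v (i + 1) \<notin> R a \<union> R b"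
proof -
  let ?S = "R a \<union> R b"
  have S: "?S \<subseteq> C" using R_sub by blast
  have fin: "finite ?S" "finite (shift ?S)" using S card_shift(1)[OF S] finC finite_subset by blast+
  have un: "card (?S \<union> shift ?S) = 2 * card ?S"
    using card_Un_disjoint[OF fin tight_disjoint_shift[OF ab]] card_shift(2)[OF S] by simp
  have sub: "?S \<union> shift ?S \<subseteq> C" using S card_shift(1)[OF S] by blast
  then show "2 * card ?S \<le> nat L" using card_mono[OF finC sub] un cardC by simp
  assume "2 * card ?S = nat L"
  then have eq: "?S \<union> shift ?S = C" using card_subset_eq[OF finC sub] un cardC by simp
  have "v (i + 1) \<in> C" by (simp add: C_def)
  then show "v i \<in> ?S \<longleftrightarrow> v (i + 1) \<notin> ?S"
    using eq tight_disjoint_shift[OF ab] mem_shift_iff[of i ?S] by blast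
qed

text \<open>With equality the union alternates, and tightness propagates \<open>R a\<close> in steps
  of two around the cycle, leaving no room for a vertex of \<open>R b\<close>.\<close>

lemma card_R_tight_less:
  assumes ab: "a \<in> U" "b \<in> U" "tight a b" and eq: "R a = {} \<longleftrightarrow> R b = {}"
  shows "2 * card (R a \<union> R b) < nat L"
proof (cases "R a = {}")
  case True
  then show ?thesis using eq L4 by simp
next
  case False
  then obtain x where "x \<in> R a" by blast
  then obtain i where i: "v i \<in> R a" using R_sub C_def by (metis imageE subsetD)
  obtain y where "y \<in> R b" using False eq by blast
  then obtain j0 where j0: "v j0 \<in> R b" using R_sub C_def by (metis imageE subsetD)
  define j where "j = i + (j0 - i) mod L"
  have "j mod L = j0 mod L" using mod_add_right_eq[of i "j0 - i" L] by (simp add: j_def)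
  then have j: "v j \<in> R b" using j0 v_eq_iff by metis
  have ij: "i \<le> j" using L4 by (simp add: j_def)
  show ?thesis
  proof (rule ccontr)
    assume "\<not> ?thesis"
    then have e: "2 * card (R a \<union> R b) = nat L" using card_R_tight(1)[OF ab] by linarith
    note alt = card_R_tight(2)[OF ab e]
    have step: "v (i + 2) \<in> R a" if "v i \<in> R a" for i
    proof -
      have "v (i + 1) \<notin> R a \<union> R b" using alt[of i] that by blast
      then have "v (i + 1 + 1) \<in> R a \<union> R b" using alt[of "i + 1"] by blast
      then have "v (i + 2) \<in> R a \<union> R b" by (simp add: add.assoc)
      then show ?thesis using ab(3) that by (auto simp: tight_def)
    qed
    have steps: "v (i + 2 * int n) \<in> R a" for n
    proof (induction n)
      case (Suc n)
      have "i + 2 * int (Suc n) = i + 2 * int n + 2" by simp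
      then show ?case using step[OF Suc] by metis
    qed (use i in simp)
    define n where "n = nat ((j - i) div 2)"
    have "j = i + 2 * int n \<or> j = i + 2 * int n + 1" using ij unfolding n_def by simp presburger
    then show False
    proof
      assume jn: "j = i + 2 * int n"
      then have "v j \<in> R a" "v (j + 2) \<in> R a" using steps[of n] step by simp_all
      then show False using ab(3) j by (auto simp: tight_def)
    next
      assume "j = i + 2 * int n + 1"
      then show False using ab(3) j steps[of n] by (auto simp: tight_def)
    qed
  qed
qed

text \<open>A blue zigzag from \<open>q\<close> to \<open>p\<close> with \<open>2 * s - 1\<close>
  vertices avoids \<open>x\<close> and \<open>y\<close>; these two close it to length
  \<open>2 * s + 1\<close>.\<close>

lemma even_no_blue_path:
  assumes L: "L = 2 * int s" "2 \<le> s" "s + 2 \<le> card U"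
    and pxyq: "distinct [p, x, y, q]" "{p, x, y, q} \<subseteq> U" "\<not> E p x" "\<not> E x y" "\<not> E y q"
  shows False
proof -
  have nL: "nat L = 2 * s" using L by linarith
  obtain us where us: "distinct us" "set us \<subseteq> U - {x, y}" "length us = s" "hd us = q" "last us = p" "us \<noteq> []"
    by (rule ex_U_list[of "{x, y}" s q p]) (use pxyq L in auto)
  have Fh: "s - 1 \<le> card (F a b \<inter> C)" if "a \<in> U" "b \<in> U" "a \<noteq> b" for a b
  proof -
    have "s - 1 \<le> card (F a b)" using card_R_Un[OF that] card_F[of a b] nL by linarith
    moreover have "F a b \<inter> C = F a b" using F_sub by blast
    ultimately show ?thesis by simp
  qed
  have "length us \<le> s - 1 + 1" "set us \<subseteq> U" using us(2,3) by auto
  then obtain zs where zs: "zs \<noteq> []" "hd zs = hd us" "last zs = last us" "distinct zs"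
    "set zs \<subseteq> set us \<union> C" "length zs = 2 * length us - 1" "successively (\<lambda>x y. \<not> E x y) zs"
    "card (set zs \<inter> C) = length us - 1"
    using blue_zigzag[OF us(6,1) _ _ Fh subset_refl] by blast
  note zs = zs[unfolded us(3-5)]
  have "x \<notin> set zs" "y \<notin> set zs" "x \<in> V" "y \<in> V"
    using zs(5) us(2) pxyq disjUC UC_V by blast+
  moreover have "set zs \<subseteq> V" using zs(5) us(2) UC_V by blast
  ultimately have "cycle_in (\<lambda>x y. \<not> E x y) V (zs @ [x, y])"
    using zs pxyq by (auto simp: cycle_in_def successively_append_iff)
  then show False using no_long_cycle[of _ "zs @ [x, y]"] zs(6) L by auto
qed

text \<open>A blue zigzag from \<open>r\<close> to \<open>p\<close> uses \<open>s - 1\<close>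
  connectors. Tightness of \<open>p q\<close> leaves a fresh \<open>w\<close>, and the strict bound
  for \<open>q r\<close> leaves one more, \<open>w'\<close>; closing through \<open>w\<close>,
  \<open>q\<close>, \<open>w'\<close> gives length \<open>2 * s + 2\<close>.\<close>

lemma even_closing:
  assumes L: "L = 2 * int s" "2 \<le> s" "s + 2 \<le> card U"
    and pqr: "p \<in> U" "q \<in> U" "r \<in> U" "p \<noteq> q" "p \<noteq> r" "q \<noteq> r" "tight p q" "tight q r"
    and eq: "R q = {} \<longleftrightarrow> R r = {}"
  shows False
proof -
  have nL: "nat L = 2 * s" using L by linarith
  obtain us where us: "distinct us" "set us \<subseteq> U - {q}" "length us = s" "hd us = r" "last us = p" "us \<noteq> []"
    by (rule ex_U_list[of "{q}" s r p]) (use pqr L in auto)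
  have Fh: "s - 1 \<le> card (F a b \<inter> C)" if "a \<in> U" "b \<in> U" "a \<noteq> b" for a b
  proof -
    have "s - 1 \<le> card (F a b)" using card_R_Un[OF that] card_F[of a b] nL by linarith
    moreover have "F a b \<inter> C = F a b" using F_sub by blast
    ultimately show ?thesis by simp
  qed
  have "length us \<le> s - 1 + 1" "set us \<subseteq> U" using us(2,3) by auto
  then obtain zs where zs: "zs \<noteq> []" "hd zs = hd us" "last zs = last us" "distinct zs"
    "set zs \<subseteq> set us \<union> C" "length zs = 2 * length us - 1" "successively (\<lambda>x y. \<not> E x y) zs"
    "card (set zs \<inter> C) = length us - 1"
    using blue_zigzag[OF us(6,1) _ _ Fh subset_refl] by blast
  note zs = zs[unfolded us(3-5)]
  have "card (set zs \<inter> C) < card (F p q)"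
    using card_R_tight(1)[OF pqr(1,2,7)] card_F[of p q] nL zs(8) L by linarith
  then obtain w where w: "w \<in> F p q" "w \<notin> set zs \<inter> C" by (rule ex_F_avoiding[rotated]) auto
  have "card (insert w (set zs \<inter> C)) \<le> s" using zs(8) L card_insert_le_m1[of s "set zs \<inter> C" w] by simp
  then have "card (insert w (set zs \<inter> C)) < card (F q r)"
    using card_R_tight_less[OF pqr(2,3,8) eq] card_F[of q r] nL by linarith
  then obtain w' where w': "w' \<in> F q r" "w' \<notin> insert w (set zs \<inter> C)" by (rule ex_F_avoiding[rotated]) auto
  have "w \<notin> set zs" "w' \<notin> set zs" "w' \<noteq> w" "q \<notin> set zs" "q \<noteq> w" "q \<noteq> w'"
    using zs(5) us(2) w w' pqr(2) F_sub disjUC by blast+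
  moreover have "set zs \<subseteq> V" "w \<in> V" "w' \<in> V" "q \<in> V"
    using zs(5) us(2) w w' pqr(2) F_sub UC_V by blast+
  ultimately have "cycle_in (\<lambda>x y. \<not> E x y) V (zs @ [w, q, w'])"
    using zs w w' by (auto simp: cycle_in_def successively_append_iff F_def)
  then show False using no_long_cycle[of _ "zs @ [w, q, w']"] zs(6) L by auto
qed

text \<open>On four outside vertices, a red graph without a 3-vertex path is a matching, so blue has
  a path through all four, which \<open>even_no_blue_path\<close> forbids. So there is a red path
  \<open>x y z\<close>, whose three pairs are all tight.\<close>

lemma even_impossible:
  assumes L: "L = 2 * int s" "2 \<le> s" "s + 2 \<le> card U"
  shows False
proof -
  obtain xs where "distinct xs" "set xs \<subseteq> U" "length xs = 4"
    using ex_distinct_list[OF finU, of 4] L by auto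
  then obtain a b c d where abcd: "distinct [a, b, c, d]" "{a, b, c, d} \<subseteq> U"
    by (auto simp: length_Suc_conv numeral_eq_Suc)
  have "\<exists>x y z. {x, y, z} \<subseteq> {a, b, c, d} \<and> distinct [x, y, z] \<and> E x y \<and> E y z"
  proof (rule ccontr)
    assume "\<not> ?thesis"
    then have no: "\<not> (E x y \<and> E y z)" if "{x, y, z} \<subseteq> {a, b, c, d}" "distinct [x, y, z]" for x y z
      using that by blast
    have P4: "E p x \<or> E x y \<or> E y q" if "distinct [p, x, y, q]" "{p, x, y, q} \<subseteq> {a, b, c, d}" for p x y q
      using even_no_blue_path[OF L that(1)] that(2) abcd(2) by blast
    have com: "E b a = E a b" "E c a = E a c" "E d a = E a d" "E c b = E b c" "E d b = E b d" "E d c = E c d"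
      using symp_commute[OF sym] by blast+
    have "\<not> (E a b \<and> E b c)" "\<not> (E a b \<and> E b d)" "\<not> (E b a \<and> E a c)" "\<not> (E b a \<and> E a d)"
      "\<not> (E a c \<and> E c d)" "\<not> (E a c \<and> E c b)" "\<not> (E c a \<and> E a d)" "\<not> (E a d \<and> E d b)"
      "\<not> (E a d \<and> E d c)" "\<not> (E b c \<and> E c d)" "\<not> (E b d \<and> E d c)" "\<not> (E c b \<and> E b d)"
      by (rule no; use abcd(1) in auto)+
    moreover have "E a b \<or> E b c \<or> E c d" "E a c \<or> E c b \<or> E b d" "E a c \<or> E c d \<or> E d b"
      "E b a \<or> E a c \<or> E c d" "E a d \<or> E d b \<or> E b c"
      by (rule P4; use abcd(1) in auto)+
    ultimately show False unfolding com by argo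
  qed
  then obtain x y z where xyz: "{x, y, z} \<subseteq> {a, b, c, d}" "distinct [x, y, z]" "E x y" "E y z"
    by blast
  have "{x, y, z} \<subseteq> U" using xyz(1) abcd(2) by (rule order_trans)
  note xyz = this xyz(2-4)
  have t: "tight x y" "tight y z" "tight x z"
    using tightI[of "[x, y]" x y] tightI[of "[y, z]" y z] tightI[of "[x, y, z]" x z] xyz by auto
  then have t': "tight y x" "tight z y" "tight z x" using tight_commute by blast+
  \<comment> \<open>Two of the three red neighbourhoods are both empty or both nonempty; that pair
    plays \<open>q r\<close>.\<close>
  show False
    using even_closing[OF L, of z x y] even_closing[OF L, of x y z] even_closing[OF L, of y x z] xyz t t'
    by auto
qed

end

lemma long_mono_cycle:
  assumes V: "finite V" "3 * k - 1 \<le> card V" and k: "3 \<le> k" and sym: "symp E"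
  shows "has_mono_cycle E V (2 * k)"
proof -
  have bound: "m \<le> card V" if "has_mono_cycle E V m" for m
    using that V(1) unfolding has_mono_cycle_def has_cycle_def cycle_in_def
    by (metis card_mono distinct_card)
  have "8 \<le> card V" using V k by linarith
  then have "has_mono_cycle E V 4" using mono_cycle_4 V sym by blast
  then obtain m where m: "has_mono_cycle E V m" and max: "\<And>j. has_mono_cycle E V j \<Longrightarrow> j \<le> m"
    using ex_has_greatest_nat[of "has_mono_cycle E V" 4 id "card V + 1"] bound
    by (metis id_apply le_imp_less_Suc Suc_eq_plus1)
  have m4: "4 \<le> m" using max \<open>has_mono_cycle E V 4\<close> by blast
  have *: False if hc: "has_cycle G V m" and symG: "symp G" and m2: "m < 2 * k"
    and maxG: "\<And>j. has_mono_cycle G V j \<Longrightarrow> j \<le> m" for G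
  proof -
    obtain xs where xs: "cycle_in G V xs" "length xs = m" using hc by (auto simp: has_cycle_def)
    obtain v where v: "cycle_map G V (int m) v" using cycle_in_cycle_map[OF xs(1)] xs(2) by metis
    interpret longest_cycle G V "int m" v
    proof
      show "\<not> has_mono_cycle G V j" if "int m < int j" for j using maxG[of j] that by auto
    qed (use V symG v m4 in auto)
    have "card U = card V - m"
      using C_sub finC cardC V(1) by (simp add: U_def card_Diff_subset)
    then have cU: "3 * k - 1 - m \<le> card U" using V by simp
    show False
    proof (cases "even m")
      case True
      then obtain s where s: "m = 2 * s" by (elim evenE)
      then have "s < k" using m2 by simp
      \<comment> \<open>From \<open>s \<le> k - 1\<close>:
        \<open>3 * k - 1 - 2 * s \<ge> s + 2\<close>. The odd case is similar and gives
        \<open>s + 1\<close>.\<close>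
      then have "s + 2 \<le> card U" "2 \<le> s" using s cU m4 by linarith+
      then show False using even_impossible[of s] s by simp
    next
      case False
      then obtain s where s: "m = 2 * s + 1" by (elim oddE)
      then have "s + 1 \<le> card U" "3 \<le> s + 1" using cU m2 m4 by linarith+
      then show False using odd_impossible[of "s + 1"] s by simp
    qed
  qed
  have "2 * k \<le> m"
    using *[of E] *[of "\<lambda>x y. \<not> E x y"] m max sym symp_neg[OF sym]
    by (force simp: has_mono_cycle_def)
  then show ?thesis using mono_cycle_descend[OF sym k m] by simp
qed

subsection \<open>Wheels\<close>

lemma edges_wheel:
  assumes "e \<in> edges (wheel n)"
  shows "(\<exists>i < n - 1. e = {Inr i, Inr (Suc i mod (n - 1))}) \<or> (\<exists>i < n - 1. e = {Inl 0, Inr i})"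
proof -
  have "edges (complete_graph 1) = {}"
    by (auto simp: complete_graph_def elim!: nsets2_E)
  then show ?thesis
    using assms by (auto simp: wheel_def graph_join_def complete_graph_def cycle_graph_def)
qed

lemma verts_wheel: "verts (wheel n) = {Inl 0} \<union> Inr ` {..<n - 1}"
  by (auto simp: wheel_def graph_join_def complete_graph_def cycle_graph_def)

lemma rim_in_wheel:
  assumes "i < n - 1"
  shows "{Inr i, Inr (Suc i mod (n - 1))} \<in> edges (wheel n)"
proof -
  have "(Inr ` {i, Suc i mod (n - 1)} :: (nat + nat) set) \<in> (\<lambda>e. Inr ` e) ` edges (cycle_graph (n - 1))"
    using assms by (intro imageI) (auto simp: cycle_graph_def)
  then show ?thesis by (simp add: wheel_def graph_join_def)
qed

lemma spoke_in_wheel: "i < n - 1 \<Longrightarrow> {Inl 0, Inr i} \<in> edges (wheel n)"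
  by (auto simp: wheel_def graph_join_def complete_graph_def cycle_graph_def)

lemma contains_wheel:
  assumes cyc: "has_cycle G A (n - 1)" and n: "4 \<le> n" and A: "A \<subseteq> {..<N} - {h}" and h: "h < N"
    and G: "\<And>x y. x \<noteq> y \<Longrightarrow> G x y \<Longrightarrow> c {x, y} = k" and spokes: "\<And>x. x \<in> A \<Longrightarrow> c {h, x} = k"
  shows "contains_copy (colour_subgraph c k (complete_graph N)) (wheel n)"
proof -
  obtain xs where xs: "cycle_in G A xs" "length xs = n - 1" using cyc by (auto simp: has_cycle_def)
  have d: "distinct xs" and A': "\<And>i. i < n - 1 \<Longrightarrow> xs ! i \<in> A"
    using xs nth_mem[of _ xs] by (auto simp: cycle_in_def)
  define f :: "nat + nat \<Rightarrow> nat" where "f = case_sum (\<lambda>_. h) (\<lambda>i. xs ! i)"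
  have f: "f (Inl 0) = h" "f (Inr i) = xs ! i" for i by (simp_all add: f_def)
  have N: "xs ! i < N" "xs ! i \<noteq> h" if "i < n - 1" for i using A'[OF that] A by auto
  have "inj_on f (verts (wheel n))"
    using d xs(2) N by (auto simp: inj_on_def verts_wheel f nth_eq_iff_index_eq)
  moreover have "f ` verts (wheel n) \<subseteq> verts (colour_subgraph c k (complete_graph N))"
    using N h by (auto simp: verts_wheel f colour_subgraph_def complete_graph_def)
  moreover have "f ` e \<in> edges (colour_subgraph c k (complete_graph N))" if e: "e \<in> edges (wheel n)" for e
    using edges_wheel[OF e]
  proof
    assume "\<exists>i < n - 1. e = {Inr i, Inr (Suc i mod (n - 1))}"
    then obtain i where i: "i < n - 1" "e = {Inr i, Inr (Suc i mod (n - 1))}" by blast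
    let ?j = "Suc i mod (n - 1)"
    have j: "?j < n - 1" "?j \<noteq> i"
      using i n by (auto simp: mod_Suc)
    have "G (xs ! i) (xs ! ?j)"
    proof (cases "Suc i = n - 1")
      case True
      then have "i = n - 2" by simp
      then show ?thesis using True xs by (auto simp: cycle_in_def last_conv_nth hd_conv_nth numeral_2_eq_2)
    next
      case False
      then show ?thesis using xs i by (auto simp: cycle_in_def successively_conv_nth)
    qed
    moreover have "xs ! i \<noteq> xs ! ?j" using d j i xs(2) by (simp add: nth_eq_iff_index_eq)
    ultimately show ?thesis
      using G N i(1) j(1) by (simp add: i(2) f colour_subgraph_def complete_graph_def)
  next
    assume "\<exists>i < n - 1. e = {Inl 0, Inr i}"
    then obtain i where "i < n - 1" "e = {Inl 0, Inr i}" by blast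
    then show ?thesis
      using N[of i] A'[of i] spokes h by (simp add: f colour_subgraph_def complete_graph_def)
  qed
  ultimately show ?thesis unfolding contains_copy_def by blast
qed

text \<open>Vertex 0 has \<open>4 * r + 1\<close> edges, hence \<open>2 * r + 1\<close> of one
  colour; \<open>n - 1 \<le> 2 * r\<close> keeps the rim length within reach of
  \<open>dense_pancyclic\<close>.\<close>

lemma wheel_arrows:
  assumes n: "4 \<le> n" and r: "n - 1 \<le> 2 * r" "2 \<le> r"
    and cycles: "\<And>E (V :: nat set). symp E \<Longrightarrow> finite V \<Longrightarrow> r \<le> card V \<Longrightarrow> has_mono_cycle E V (n - 1)"
  shows "ramsey_arrows (4 * r + 2) (wheel n) (wheel n)"
  unfolding ramsey_arrows_def
proof
  fix c :: "nat set \<Rightarrow> colour"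
  let ?N = "4 * r + 2" and ?m = "n - 1"
  let ?V = "{..<?N}"
  define W where "W k = contains_copy (colour_subgraph c k (complete_graph ?N)) (wheel n)" for k
  have *: "W Red \<or> W Blue" if G: "\<And>x y. G x y \<longleftrightarrow> c {x, y} = k" and k': "k \<noteq> k'"
    and deg: "2 * r + 1 \<le> card {y \<in> ?V - {0}. G 0 y}" for G k k'
  proof -
    have Wk: "W k \<or> W k' \<Longrightarrow> W Red \<or> W Blue" by (metis colour.exhaust)
    have G': "\<not> G x y \<longleftrightarrow> c {x, y} = k'" for x y
      using k' G by (metis colour.exhaust)
    have symG: "symp G" by (auto simp: symp_def G insert_commute)
    obtain A where A: "A \<subseteq> {y \<in> ?V - {0}. G 0 y}" "card A = 2 * r + 1" "finite A"
      using obtain_subset_with_card_n[OF deg] by metis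
    have redA: "has_cycle G A ?m \<Longrightarrow> W k"
      unfolding W_def using A n G by (intro contains_wheel[of G A n ?N 0]) auto
    show ?thesis
    \<comment> \<open>A cycle in \<open>?B\<close> of colour \<open>k\<close> takes 0 as its hub,
      one of colour \<open>k'\<close> takes \<open>x\<close>.\<close>
    proof (cases "\<exists>x\<in>A. r \<le> card {y \<in> A - {x}. \<not> G x y}")
      case True
      then obtain x where x: "x \<in> A" "r \<le> card {y \<in> A - {x}. \<not> G x y}" by blast
      let ?B = "{y \<in> A - {x}. \<not> G x y}"
      have "has_mono_cycle G ?B ?m" using cycles[OF symG _ x(2)] A by simp
      then show ?thesis unfolding has_mono_cycle_def
      proof
        assume "has_cycle G ?B ?m"
        then have "has_cycle G A ?m" by (rule has_cycle_mono) auto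
        then show ?thesis using redA Wk by blast
      next
        assume "has_cycle (\<lambda>x y. \<not> G x y) ?B ?m"
        then have "W k'"
          unfolding W_def using A x n G' by (intro contains_wheel[of _ ?B n ?N x]) auto
        then show ?thesis using Wk by blast
      qed
    next
      case False
      have "r + 1 \<le> card {y \<in> A - {x}. G x y}" if x: "x \<in> A" for x
      proof -
        have "card (A - {x}) \<le> card {y \<in> A - {x}. G x y} + card {y \<in> A - {x}. \<not> G x y}"
          by (rule card_le_filter_add)
        moreover have "card (A - {x}) = 2 * r" using A x by simp
        moreover have "card {y \<in> A - {x}. \<not> G x y} < r" using False x by auto
        ultimately show ?thesis by linarith
      qed
      then have "has_cycle G A ?m" using A r n symG by (intro dense_pancyclic[of A r]) auto
      then show ?thesis using redA Wk by blast
    qed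
  qed
  have "c e \<noteq> Red \<longleftrightarrow> c e = Blue" for e by (cases "c e") auto
  then have "card (?V - {0}) \<le> card {y \<in> ?V - {0}. c {0, y} = Red} + card {y \<in> ?V - {0}. c {0, y} = Blue}"
    using card_le_filter_add[of "?V - {0}" "\<lambda>y. c {0, y} = Red"] by simp
  moreover have "card (?V - {0}) = 4 * r + 1" by simp
  ultimately have "2 * r + 1 \<le> card {y \<in> ?V - {0}. c {0, y} = Red} \<or> 2 * r + 1 \<le> card {y \<in> ?V - {0}. c {0, y} = Blue}"
    by linarith
  then show "contains_copy (colour_subgraph c Red (complete_graph ?N)) (wheel n) \<or>
    contains_copy (colour_subgraph c Blue (complete_graph ?N)) (wheel n)"
    using *[of "\<lambda>x y. c {x, y} = Red" Red Blue] *[of "\<lambda>x y. c {x, y} = Blue" Blue Red]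
    unfolding W_def by blast
qed

text \<open>\<open>p\<close> disjoint red cliques of size \<open>n - 1\<close>: red components are too small for the wheel, and the
  blue graph is \<open>p\<close>-partite.\<close>
lemma wheel_lower_bound:
  assumes n: "4 \<le> n" and p: "0 < p" and N: "N \<le> p * (n - 1)"
    and chromatic: "\<And>g :: nat + nat \<Rightarrow> nat. (\<And>x. x \<in> verts (wheel n) \<Longrightarrow> g x < p) \<Longrightarrow>
      (\<And>x y. {x, y} \<in> edges (wheel n) \<Longrightarrow> g x \<noteq> g y) \<Longrightarrow> False"
  shows "\<not> ramsey_arrows N (wheel n) (wheel n)"
proof -
  \<comment> \<open>The red cliques are blocks of \<open>n - 1\<close> consecutive numbers, and
    \<open>N \<le> p * (n - 1)\<close> allows at most \<open>p\<close> blocks.\<close>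
  define c where "c e = (if \<exists>t. \<forall>x\<in>e. x div (n - 1) = t then Red else Blue)" for e :: "nat set"
  have c: "c {x, y} = Red \<longleftrightarrow> x div (n - 1) = y div (n - 1)" for x y
    by (auto simp: c_def)
  have edge: "c (f ` e) = k" if "\<forall>e\<in>edges (wheel n). f ` e \<in> edges (colour_subgraph c k (complete_graph N))"
    "e \<in> edges (wheel n)" for e f k
    using that by (auto simp: colour_subgraph_def)
  have "\<not> contains_copy (colour_subgraph c Red (complete_graph N)) (wheel n)"
  proof
    assume "contains_copy (colour_subgraph c Red (complete_graph N)) (wheel n)"
    then obtain f where f: "inj_on f (verts (wheel n))"
      "\<forall>e\<in>edges (wheel n). f ` e \<in> edges (colour_subgraph c Red (complete_graph N))"
      unfolding contains_copy_def by blast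
    let ?t = "f (Inl 0) div (n - 1)"
    \<comment> \<open>Red spokes keep the copy in the block of its hub, which is one vertex too
      small.\<close>
    have "f ` verts (wheel n) \<subseteq> {?t * (n - 1)..<?t * (n - 1) + (n - 1)}"
    proof
      fix y assume "y \<in> f ` verts (wheel n)"
      then obtain x where x: "y = f x" "x \<in> verts (wheel n)" by blast
      have "y div (n - 1) = ?t"
      proof (cases "x = Inl 0")
        case False
        then obtain i where i: "x = Inr i" "i < n - 1" using x by (auto simp: verts_wheel)
        then have "c (f ` {Inl 0, Inr i}) = Red" using edge[OF f(2)] spoke_in_wheel by blast
        then show ?thesis using i x c by simp
      qed (use x in simp)
      then have "y = ?t * (n - 1) + y mod (n - 1)" using div_mult_mod_eq[of y "n - 1"] by simp
      moreover have "y mod (n - 1) < n - 1" using n by simp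
      ultimately show "y \<in> {?t * (n - 1)..<?t * (n - 1) + (n - 1)}"
        unfolding atLeastLessThan_iff by linarith
    qed
    then have "card (f ` verts (wheel n)) \<le> n - 1"
      using card_mono[of "{?t * (n - 1)..<?t * (n - 1) + (n - 1)}"] by fastforce
    then show False
      using f(1) simple_graph_wheel(2)[OF n] n by (simp add: card_image)
  qed
  moreover have "\<not> contains_copy (colour_subgraph c Blue (complete_graph N)) (wheel n)"
  proof
    assume "contains_copy (colour_subgraph c Blue (complete_graph N)) (wheel n)"
    then obtain f where f: "f ` verts (wheel n) \<subseteq> {..<N}"
      "\<forall>e\<in>edges (wheel n). f ` e \<in> edges (colour_subgraph c Blue (complete_graph N))"
      unfolding contains_copy_def by (auto simp: colour_subgraph_def complete_graph_def)
    \<comment> \<open>For a blue copy, the block number is a proper colouring of the wheel.\<close>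
    show False
    proof (rule chromatic[of "\<lambda>x. f x div (n - 1)"])
      fix x assume "x \<in> verts (wheel n)"
      then have "f x < p * (n - 1)" using f(1) N by force
      then show "f x div (n - 1) < p" by (simp add: less_mult_imp_div_less)
    next
      fix x y assume "{x, y} \<in> edges (wheel n)"
      then have "c (f ` {x, y}) = Blue" using edge[OF f(2)] by blast
      then show "f x div (n - 1) \<noteq> f y div (n - 1)" using c[of "f x" "f y"] by auto
    qed
  qed
  ultimately show ?thesis unfolding ramsey_arrows_def by blast
qed

text \<open>The hub and two consecutive rim vertices form a triangle.\<close>

lemma wheel_not_2_colourable:
  assumes "4 \<le> n" "\<And>x. x \<in> verts (wheel n) \<Longrightarrow> g x < (2::nat)"
    and "\<And>x y. {x, y} \<in> edges (wheel n) \<Longrightarrow> g x \<noteq> g y"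
  shows False
proof -
  have "Suc 0 mod (n - 1) = Suc 0" by (rule mod_less) (use assms(1) in simp)
  then have e: "{Inr 0, Inr 1} \<in> edges (wheel n)" using rim_in_wheel[of 0 n] assms(1) by simp
  have "g (Inl 0) < 2" "g (Inr 0) < 2" "g (Inr 1) < 2"
    using assms(1,2) by (auto simp: verts_wheel)
  moreover have "g (Inl 0) \<noteq> g (Inr 0)" "g (Inl 0) \<noteq> g (Inr 1)" "g (Inr 0) \<noteq> g (Inr 1)"
    using assms(1,3) spoke_in_wheel[of 0 n] spoke_in_wheel[of 1 n] e by auto
  ultimately show False by linarith
qed

text \<open>Apart from the hub's colour only two remain, so the rim colours alternate; the rim has
  odd length, so its ends \<open>n - 2\<close> and 0 clash.\<close>

lemma even_wheel_not_3_colourable: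
  assumes n: "4 \<le> n" "even n" and g: "\<And>x. x \<in> verts (wheel n) \<Longrightarrow> g x < (3::nat)"
    and proper: "\<And>x y. {x, y} \<in> edges (wheel n) \<Longrightarrow> g x \<noteq> g y"
  shows False
proof -
  have hub: "g (Inl 0) < 3" using g by (simp add: verts_wheel)
  have rim: "g (Inr i) < 3" "g (Inr i) \<noteq> g (Inl 0)" if "i < n - 1" for i
    using g[of "Inr i"] proper[OF spoke_in_wheel[OF that]] that by (auto simp: verts_wheel)
  have step: "g (Inr i) \<noteq> g (Inr (Suc i mod (n - 1)))" if "i < n - 1" for i
    using proper[OF rim_in_wheel[OF that]] .
  have step2: "g (Inr (Suc (Suc i))) = g (Inr i)" if "Suc (Suc i) < n - 1" for i
    using step[of i] step[of "Suc i"] rim[of i] rim[of "Suc i"] rim[of "Suc (Suc i)"] hub that by simp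
  have alt: "2 * j < n - 1 \<Longrightarrow> g (Inr (2 * j)) = g (Inr 0)" for j
    by (induction j) (use step2 in auto)
  obtain j where j: "n = 2 * j" using n(2) by (elim evenE)
  have "g (Inr (2 * (j - 1))) = g (Inr 0)" using alt[of "j - 1"] j n by simp
  moreover have "2 * (j - 1) = n - 2" "Suc (n - 2) = n - 1" using j n by auto
  ultimately show False using step[of "n - 2"] n by simp
qed

section \<open>Bounds on the Ramsey number\<close>

lemma ramsey_number_wheel_bounds:
  assumes n: "4 \<le> n"
  shows "ramsey_arrows N (wheel n) (wheel n) \<Longrightarrow> ramsey_number (wheel n) (wheel n) \<le> N"
    and "(\<And>M. M < N \<Longrightarrow> \<not> ramsey_arrows M (wheel n) (wheel n)) \<Longrightarrow> N \<le> ramsey_number (wheel n) (wheel n)"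
proof -
  show "ramsey_arrows N (wheel n) (wheel n) \<Longrightarrow> ramsey_number (wheel n) (wheel n) \<le> N"
    unfolding ramsey_number_def by (rule Least_le)
  \<comment> \<open>The minimum is attained because some number arrows; without this
    \<open>LEAST\<close> would say nothing.\<close>
  have "ramsey_arrows (ramsey_number (wheel n) (wheel n)) (wheel n) (wheel n)"
    unfolding ramsey_number_def
    using ramsey_arrows_exists[OF simple_graph_wheel(1)[OF n] simple_graph_wheel(1)[OF n]] by (rule LeastI_ex)
  then show "(\<And>M. M < N \<Longrightarrow> \<not> ramsey_arrows M (wheel n) (wheel n)) \<Longrightarrow> N \<le> ramsey_number (wheel n) (wheel n)"
    by (meson not_le)
qed

theorem theorem6:
  fixes n :: nat
  assumes "n \<ge> 7"
  shows "(even n \<longrightarrow> 3 * n - 3 \<le> ramsey_number (wheel n) (wheel n)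
                   \<and> ramsey_number (wheel n) (wheel n) \<le> 8 * n - 10)
       \<and> (odd n \<longrightarrow> 2 * n - 2 \<le> ramsey_number (wheel n) (wheel n)
                  \<and> ramsey_number (wheel n) (wheel n) \<le> 6 * n - 8)"
proof (intro conjI impI)
  have n: "4 \<le> n" using assms by simp
  show "3 * n - 3 \<le> ramsey_number (wheel n) (wheel n)" if "even n"
  proof (rule ramsey_number_wheel_bounds(2)[OF n])
    fix M assume "M < 3 * n - 3"
    then show "\<not> ramsey_arrows M (wheel n) (wheel n)"
      using even_wheel_not_3_colourable[OF n that] by (intro wheel_lower_bound[OF n, of 3]) auto
  qed
  show "2 * n - 2 \<le> ramsey_number (wheel n) (wheel n)"
  proof (rule ramsey_number_wheel_bounds(2)[OF n])
    fix M assume "M < 2 * n - 2"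
    then show "\<not> ramsey_arrows M (wheel n) (wheel n)"
      using wheel_not_2_colourable[OF n] by (intro wheel_lower_bound[OF n, of 2]) auto
  qed
  show "ramsey_number (wheel n) (wheel n) \<le> 8 * n - 10" if ev: "even n"
  proof -
    \<comment> \<open>The rim has odd length \<open>2 * k - 1\<close>, so
      \<open>r = 4 * k - 3\<close>.\<close>
    obtain k where k: "n = 2 * k" using ev by (elim evenE)
    have k3: "3 \<le> k" using k assms by simp
    have "has_mono_cycle E V (n - 1)"
      if V: "finite V" "4 * k - 3 \<le> card V" and sym: "symp E" for E and V :: "nat set"
    proof -
      have "has_mono_cycle E V (2 * k)" using V k3 by (intro long_mono_cycle[OF V(1) _ k3 sym]) simp
      then show ?thesis using even_mono_cycle_to_odd[OF sym _ k3 V] k by simp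
    qed
    then have "ramsey_arrows (4 * (4 * k - 3) + 2) (wheel n) (wheel n)"
      using k k3 by (intro wheel_arrows[OF n]) auto
    moreover have "4 * (4 * k - 3) + 2 = 8 * n - 10" using k k3 by simp
    ultimately show ?thesis using ramsey_number_wheel_bounds(1)[OF n] by simp
  qed
  show "ramsey_number (wheel n) (wheel n) \<le> 6 * n - 8" if od: "odd n"
  proof -
    \<comment> \<open>The rim has even length \<open>2 * k\<close>, so the smaller
      \<open>r = 3 * k - 1\<close> suffices.\<close>
    obtain k where k: "n = 2 * k + 1" using od by (elim oddE)
    have k3: "3 \<le> k" using k assms by simp
    have "has_mono_cycle E V (n - 1)"
      if V: "finite V" "3 * k - 1 \<le> card V" and sym: "symp E" for E and V :: "nat set"
      using long_mono_cycle[OF V k3 sym] k by simp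
    then have "ramsey_arrows (4 * (3 * k - 1) + 2) (wheel n) (wheel n)"
      using k k3 by (intro wheel_arrows[OF n]) auto
    moreover have "4 * (3 * k - 1) + 2 = 6 * n - 8" using k k3 by simp
    ultimately show ?thesis using ramsey_number_wheel_bounds(1)[OF n] by simp
  qed
qed

end
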